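(* Consider the problem $$\min_{x\in\mathbb R^n}\ F(x)\equiv f(x)+g(x)+h_1(A_1x)\quad\text{s.t.}\quad A_2x\in\mathcal K,$$ with $A_1\in\mathbb R^{d_1\times n}$, $A_2\in\mathbb R^{d_2\times n}$, $A=\begin{pmatrix} A_1 \\ A_2 \end{pmatrix}$, under the standing assumptions in the context, and assume $f$ is relatively smooth: there is a convex function $\xi$, differentiable on an open set containing $\operatorname{dom}(g)$, and $L_f>\mu>0$ such that $$\mu D_\xi(y;x)\le D_f(y;x)\le L_fD_\xi(y;x),\qquad\forall x,y\in\operatorname{dom}(g),$$ where $D_\phi(y;x)=\phi(y)-\phi(x)-\langle\nabla\phi(x),y-x\rangle$; moreover, for all $\alpha,\beta>0$, $x\in\operatorname{dom}(\xi)$, $x'\in\mathbb R^n$ the problem $\min_y\{g(y)+\frac\beta2\|y-x'\|^2+\alpha D_\xi(y;x)\}$ is (easily) solvable. Let $\mu_g\ge0$ be the strong convexity parameter of $g$. Apply Algorithm IPALM($\mathcal A$) (described in the context) with $\eta<\rho$ and with the Bregman proximal gradient method as inner solver $\mathcal A$. Then to obtain a solution $x^s$ with $|\mathbb E[F(x^s)-F^\star]|\le\epsilon$ and $\mathbb E[\operatorname{dist}(A_2x^s,\mathcal K)]\le\epsilon$, the expected number of Bregman proximal gradient iterations is bounded by $$\begin{cases}\tilde O\left(\dfrac{\max(\|A\|^2,L_f\beta_0)+\min(\mu_g,\mu)}{\min(\mu_g,\mu)\,\epsilon}\right)&\text{if }\min(\mu_g,\mu)>0,\\[3mm] \tilde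 O\left(\dfrac{\max(\|A\|^2,L_f\beta_0)}{\epsilon^2}\right)&\text{if }\min(\mu_g,\mu)=0.\end{cases}$$
   Context: Setting. Let $d=d_1+d_2$; for $\lambda\in\mathbb R^d$ write $\lambda=(\lambda_1;\lambda_2)$ with $\lambda_i\in\mathbb R^{d_i}$. $\|\cdot\|$ is the Euclidean norm for vectors and the spectral norm for matrices. $g:\mathbb R^n\to\mathbb R\cup\{+\infty\}$ and $h_1:\mathbb R^{d_1}\to\mathbb R$ are proper, convex, closed; $h_2$ is the indicator function of a nonempty closed convex set $\mathcal K\subset\mathbb R^{d_2}$; $f:\mathbb R^n\to\mathbb R\cup\{+\infty\}$ is convex and differentiable on an open set containing $\operatorname{dom}(g)$. Put $p(x)=Ax$, $h(u)=h_1(u_1)+h_2(u_2)$, $h^*$ the Fenchel conjugate; $F^\star$ is the optimal value of the problem; $L(x;\lambda)=f(x)+g(x)+\langle\lambda,p(x)\rangle-h^*(\lambda)$, $D(\lambda)=\inf_xL(x;\lambda)$. Standing assumptions: $h_1$ is $L_{h_1}$-Lipschitz; the primal problem and the dual problem $\max_\lambda D(\lambda)$ have optimal solutions and strong duality holds: there are $x^\star\in\operatorname{dom}(g)$, $\lambda^\star\in\operatorname{dom}(h^* )$ with $A_2x^\star\in\mathcal K$ and $F(x^\star)=L(x^\star;\lambda^\star)=D(\lambda^\star)$. Below $x^\star,\lambda^\star$ are arbitrary primal and dual optimal solutions. Smoothing. For $u,\lambda\in\mathbb R^d$, $\beta>0$: $h(u;\lambda,\beta)=\max_v\{\langle v,u\rangle-h^*(v)-\frac\beta2\|v-\lambda\|^2\}$,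 $\Lambda(u;\lambda,\beta)$ is its unique maximizer, and $L(x;y,\lambda,\beta)=f(x)+g(x)+h(p(x);\lambda,\beta)+\frac\beta2\|x-y\|^2$. Algorithm IPALM($\mathcal A$). Parameters $\beta_0>0$, $\rho\in(1/2,1)$, $\eta\in(0,1)$, positive integer $m_0$; initial (deterministic) $x^{-1}\in\operatorname{dom}(g)$, $\lambda^0\in\operatorname{dom}(h^* )$. Write $H_s(x)=L(x;x^{s-1},\lambda^s,\beta_s)$, $H_s^\star=\min_xH_s(x)$, $\beta_s=\beta_0\rho^s$, $\epsilon_s=\epsilon_0\eta^s$. Set $x^0=\mathcal A(x^{-1},m_0,H_0)$ and let $\epsilon_0>0$ be a constant with $\epsilon_0\ge H_0(x^0)-H_0^\star$. For $s=0,1,2,\dots$: $\lambda^{s+1}=\Lambda(p(x^s);\lambda^s,\beta_s)$; $m_{s+1}$ is the smallest positive integer such that $2\epsilon_s+M_s\le 2^{\lfloor m_{s+1}/K_{s+1}\rfloor}\epsilon_{s+1}/2$; $x^{s+1}=\mathcal A(x^s,m_{s+1},H_{s+1})$. Here $$M_s=\beta_s\|\lambda^{s+1}-\lambda^s\|^2+\tfrac{\beta_s-\beta_{s+1}}2\|\Lambda(p(x^s);\lambda^{s+1},\beta_{s+1})-\lambda^{s+1}\|^2+\tfrac{\beta_s^2}{2\beta_{s+1}-\beta_s}\|x^{s-1}-x^s\|^2$$ $$\qquad+\|\lambda^{s+1}-\lambda^s\|\sqrt{\left((\beta_s+\beta_{s+1})L_{h_1}+\|\beta_s\lambda_1^s-\beta_{s+1}\lambda_1^{s+1}\|\right)^2+\|\beta_s\lambda_2^s-\beta_{s+1}\lambda_2^{s+1}\|^2}.$$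 $\mathcal A(x,k,H_s)$ denotes the output of $k$ iterations of $\mathcal A$ on $\min H_s$ started at $x$. Inner solver guarantee (taken as given). The Bregman proximal gradient method (with reference function $\xi+\frac12\|\cdot\|^2$), applied to $H_s$ split as $f(x)+h(Ax;\lambda^s,\beta_s)$ plus $g(x)+\frac{\beta_s}2\|x-x^{s-1}\|^2$, satisfies $H_s(\mathcal A(x,k,H_s))-H_s^\star\le2^{-\lfloor k/K_s\rfloor}(H_s(x)-H_s^\star)$ for all $x\in\operatorname{dom}(g)$ and $k$, with a deterministic $K_s\ge1$ satisfying $K_s\le\frac{2\max(\beta_s^{-1}\|A\|^2,L_f)}{\min(\beta_s+\mu_g,\mu)}+1$; this $K_s$ is used in the algorithm. Convention for $\tilde O$. Let $c_0=2\left(\|(x^{-1},\lambda^0)-(x^\star,\lambda^\star)\|+\frac{2\sqrt{\epsilon_0/\beta_0}}{1-\sqrt{\eta/\rho}}\right)^2+2\|\lambda^\star\|^2+2\|x^\star\|^2$, $c_1=\max(\epsilon_0+2L_{h_1}^2\beta_0+c_0\beta_0,\beta_0\|\lambda_2^\star\|\sqrt{c_0},\beta_0\sqrt{c_0})$, $c_2=\log_2\left(\frac4\eta+\frac{2\beta_0((11+2\rho^{-2})(L_{h_1}^2+4c_0)+4(2\rho-1)^{-1}c_0)}{\epsilon_0\eta}\right)+1$. $\tilde O$ hides logarithmic terms and constants depending only on the order in $1/\epsilon$ and on $c_1,c_2,\rho,\eta,\beta_0,\epsilon_0,m_0$: "bounded by $\tilde O(q(\epsilon))$" means there are $C,k>0$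 depending only on these quantities such that, for all sufficiently small $\epsilon>0$, some $s$ with the required accuracy satisfies $\sum_{t=0}^s\mathbb E[m_t]\le C\,q(\epsilon)\,(1+\ln(1/\epsilon))^k$. *)

theory Defs
  imports "HOL-Probability.Probability_Measure"
begin

text \<open>
  The constants hidden by the order notation must not depend on the dimensions, so the dimensions
  are quantified inside the statement and cannot be types. All spaces \<open>R\<^sup>n\<close> therefore
  live in one inner product space: \<open>fvec\<close> consists of the finitely supported real sequences
  with the Euclidean inner product, and \<open>Rn n\<close> is the subspace of the sequences that vanish
  from index \<open>n\<close> on. A vector of \<open>R\<^sup>d\<close>, \<open>d = d\<^sub>1 + d\<^sub>2\<close>, split into
  two blocks is a pair; the library inner product and norm of pairs are the Euclidean ones.
\<close>

typedef fvec = "{v :: nat \<Rightarrow> real. finite {i. v i \<noteq> 0}}"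
  morphisms coord Abs_fvec
  by (rule exI[of _ "\<lambda>_. 0"]) simp

setup_lifting type_definition_fvec

lemma finite_coord [simp]: "finite {i. coord v i \<noteq> 0}"
  using coord[of v] by simp

instantiation fvec :: real_vector
begin

lift_definition zero_fvec :: fvec is "\<lambda>_. 0" by simp

lift_definition plus_fvec :: "fvec \<Rightarrow> fvec \<Rightarrow> fvec" is "\<lambda>u v i. u i + v i"
  by (erule (1) rev_finite_subset[OF finite_UnI]) auto

lift_definition minus_fvec :: "fvec \<Rightarrow> fvec \<Rightarrow> fvec" is "\<lambda>u v i. u i - v i"
  by (erule (1) rev_finite_subset[OF finite_UnI]) auto

lift_definition uminus_fvec :: "fvec \<Rightarrow> fvec" is "\<lambda>v i. - v i" by simp

lift_definition scaleR_fvec :: "real \<Rightarrow> fvec \<Rightarrow> fvec" is "\<lambda>r v i. r * v i"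
  by (rule finite_subset[of _ "{i. _ i \<noteq> 0}"]) auto

instance
  by standard (transfer, auto simp: algebra_simps)+

end

lemmas coord_simps [simp] =
  zero_fvec.rep_eq plus_fvec.rep_eq minus_fvec.rep_eq uminus_fvec.rep_eq scaleR_fvec.rep_eq

instantiation fvec :: real_inner
begin

definition inner_fvec :: "fvec \<Rightarrow> fvec \<Rightarrow> real"
  where "inner_fvec u v = (\<Sum>i | coord u i \<noteq> 0. coord u i * coord v i)"

definition norm_fvec :: "fvec \<Rightarrow> real"
  where "norm_fvec v = sqrt (v \<bullet> v)"

definition sgn_fvec :: "fvec \<Rightarrow> fvec"
  where "sgn_fvec v = v /\<^sub>R norm v"

definition dist_fvec :: "fvec \<Rightarrow> fvec \<Rightarrow> real"
  where "dist_fvec u v = norm (u - v)"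

definition uniformity_fvec :: "(fvec \<times> fvec) filter"
  where "uniformity_fvec = (INF e\<in>{0<..}. principal {(u, v). dist u v < e})"

definition open_fvec :: "fvec set \<Rightarrow> bool"
  where "open_fvec U \<longleftrightarrow> (\<forall>u\<in>U. \<forall>\<^sub>F (u', v) in uniformity. u' = u \<longrightarrow> v \<in> U)"

lemma inner_fvec_superset:
  assumes "finite S" and "\<And>i. coord u i \<noteq> 0 \<Longrightarrow> coord v i \<noteq> 0 \<Longrightarrow> i \<in> S"
  shows "u \<bullet> v = (\<Sum>i\<in>S. coord u i * coord v i)"
proof -
  have "u \<bullet> v = (\<Sum>i\<in>{i. coord u i \<noteq> 0} \<union> S. coord u i * coord v i)"
    unfolding inner_fvec_def using assms(1) by (intro sum.mono_neutral_left) auto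
  also have "\<dots> = (\<Sum>i\<in>S. coord u i * coord v i)"
    using assms by (intro sum.mono_neutral_right) auto
  finally show ?thesis .
qed

instance
proof
  fix u v w :: fvec and r :: real
  let ?S = "{i. coord u i \<noteq> 0} \<union> {i. coord v i \<noteq> 0} \<union> {i. coord w i \<noteq> 0}"
  have fin: "finite ?S" by simp
  show "u \<bullet> v = v \<bullet> u"
    by (subst (1 2) inner_fvec_superset[OF fin]) (auto simp: mult.commute)
  show "(u + v) \<bullet> w = u \<bullet> w + v \<bullet> w"
    by (subst (1 2 3) inner_fvec_superset[OF fin]) (auto simp: algebra_simps sum.distrib)
  show "(r *\<^sub>R u) \<bullet> v = r * (u \<bullet> v)"
    by (subst (1 2) inner_fvec_superset[OF fin]) (auto simp: sum_distrib_left algebra_simps)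
  show "0 \<le> u \<bullet> u"
    unfolding inner_fvec_def by (intro sum_nonneg) simp
  show "u \<bullet> u = 0 \<longleftrightarrow> u = 0"
    unfolding inner_fvec_def
    by (subst sum_nonneg_eq_0_iff) (auto simp: coord_inject[symmetric] fun_eq_iff)
qed (simp_all add: norm_fvec_def sgn_fvec_def dist_fvec_def uniformity_fvec_def open_fvec_def)

end

definition Rn :: "nat \<Rightarrow> fvec set"
  where "Rn n = {v. \<forall>i\<ge>n. coord v i = 0}"

lift_definition mat_vec :: "nat \<Rightarrow> nat \<Rightarrow> (nat \<Rightarrow> nat \<Rightarrow> real) \<Rightarrow> fvec \<Rightarrow> fvec"
  is "\<lambda>d n A v i. if i < d then \<Sum>j<n. A i j * v j else 0"
  by (rule finite_subset[of _ "{..<d}" for d]) auto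


definition edom :: "nat \<Rightarrow> (fvec \<Rightarrow> ereal) \<Rightarrow> fvec set"
  where "edom n \<phi> = {x \<in> Rn n. \<phi> x < \<infinity>}"

definition epi :: "nat \<Rightarrow> (fvec \<Rightarrow> ereal) \<Rightarrow> (fvec \<times> real) set"
  where "epi n \<phi> = {(x, t). x \<in> Rn n \<and> \<phi> x \<le> ereal t}"

definition convex_fun :: "nat \<Rightarrow> (fvec \<Rightarrow> ereal) \<Rightarrow> bool"
  where "convex_fun n \<phi> \<longleftrightarrow> (\<forall>x\<in>Rn n. \<phi> x \<noteq> -\<infinity>) \<and> convex (epi n \<phi>)"

definition proper_convex_closed :: "nat \<Rightarrow> (fvec \<Rightarrow> ereal) \<Rightarrow> bool"
  where "proper_convex_closed n \<phi> \<longleftrightarrow>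
    edom n \<phi> \<noteq> {} \<and> convex_fun n \<phi> \<and> closed (epi n \<phi>)"

definition strongly_convex :: "nat \<Rightarrow> real \<Rightarrow> (fvec \<Rightarrow> ereal) \<Rightarrow> bool"
  where "strongly_convex n \<mu> \<phi> \<longleftrightarrow> convex_fun n (\<lambda>x. \<phi> x - ereal (\<mu> / 2 * (norm x)\<^sup>2))"

text \<open>Finiteness near \<open>x\<close> is required because \<open>real_of_ereal \<infinity> = 0\<close>.\<close>

definition has_gradient :: "nat \<Rightarrow> (fvec \<Rightarrow> ereal) \<Rightarrow> fvec \<Rightarrow> fvec \<Rightarrow> bool"
  where "has_gradient n \<phi> x v \<longleftrightarrow> x \<in> Rn n \<and> v \<in> Rn n \<and>
    \<bar>\<phi> x\<bar> \<noteq> \<infinity> \<and> (\<forall>\<^sub>F y in at x within Rn n. \<bar>\<phi> y\<bar> \<noteq> \<infinity>) \<and>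
    ((\<lambda>y. real_of_ereal (\<phi> y)) has_derivative (\<lambda>z. v \<bullet> z)) (at x within Rn n)"

definition grad :: "nat \<Rightarrow> (fvec \<Rightarrow> ereal) \<Rightarrow> fvec \<Rightarrow> fvec"
  where "grad n \<phi> x = (THE v. has_gradient n \<phi> x v)"

definition differentiable_around :: "nat \<Rightarrow> (fvec \<Rightarrow> ereal) \<Rightarrow> fvec set \<Rightarrow> bool"
  where "differentiable_around n \<phi> S \<longleftrightarrow>
    (\<exists>U. openin (top_of_set (Rn n)) U \<and> S \<subseteq> U \<and> (\<forall>x\<in>U. \<exists>v. has_gradient n \<phi> x v))"

definition bregman :: "nat \<Rightarrow> (fvec \<Rightarrow> ereal) \<Rightarrow> fvec \<Rightarrow> fvec \<Rightarrow> ereal"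
  where "bregman n \<phi> y x = \<phi> y - \<phi> x - ereal (grad n \<phi> x \<bullet> (y - x))"


record problem =
  dimx :: nat
  dim1 :: nat
  dim2 :: nat
  pf :: "fvec \<Rightarrow> ereal"
  pg :: "fvec \<Rightarrow> ereal"
  ph1 :: "fvec \<Rightarrow> real"
  pK :: "fvec set"
  pA1 :: "nat \<Rightarrow> nat \<Rightarrow> real"
  pA2 :: "nat \<Rightarrow> nat \<Rightarrow> real"

definition A1 :: "problem \<Rightarrow> fvec \<Rightarrow> fvec"
  where "A1 P x = mat_vec (dim1 P) (dimx P) (pA1 P) x"

definition A2 :: "problem \<Rightarrow> fvec \<Rightarrow> fvec"
  where "A2 P x = mat_vec (dim2 P) (dimx P) (pA2 P) x"

definition Amat :: "problem \<Rightarrow> fvec \<Rightarrow> fvec \<times> fvec"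
  where "Amat P x = (A1 P x, A2 P x)"

text \<open>\<open>Amat P\<close> ignores the coordinates beyond \<open>dimx P\<close>, so its operator norm on the whole of
  \<open>fvec\<close> is the spectral norm of the matrix.\<close>

definition normA :: "problem \<Rightarrow> real"
  where "normA P = onorm (Amat P)"

abbreviation Rx :: "problem \<Rightarrow> fvec set"
  where "Rx P \<equiv> Rn (dimx P)"

abbreviation Rd :: "problem \<Rightarrow> (fvec \<times> fvec) set"
  where "Rd P \<equiv> Rn (dim1 P) \<times> Rn (dim2 P)"

abbreviation domg :: "problem \<Rightarrow> fvec set"
  where "domg P \<equiv> edom (dimx P) (pg P)"

definition Fobj :: "problem \<Rightarrow> fvec \<Rightarrow> ereal"
  where "Fobj P x = pf P x + pg P x + ereal (ph1 P (A1 P x))"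

definition feasible :: "problem \<Rightarrow> fvec set"
  where "feasible P = {x \<in> Rx P. A2 P x \<in> pK P}"

definition Fstar :: "problem \<Rightarrow> ereal"
  where "Fstar P = (INF x\<in>feasible P. Fobj P x)"

definition hsum :: "problem \<Rightarrow> fvec \<times> fvec \<Rightarrow> ereal"
  where "hsum P u = ereal (ph1 P (fst u)) + (if snd u \<in> pK P then 0 else \<infinity>)"

definition hconj :: "problem \<Rightarrow> fvec \<times> fvec \<Rightarrow> ereal"
  where "hconj P v = (SUP u\<in>Rd P. ereal (v \<bullet> u) - hsum P u)"

definition domhconj :: "problem \<Rightarrow> (fvec \<times> fvec) set"
  where "domhconj P = {v \<in> Rd P. hconj P v < \<infinity>}"

definition Lagr :: "problem \<Rightarrow> fvec \<Rightarrow> fvec \<times> fvec \<Rightarrow> ereal"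
  where "Lagr P x lam = pf P x + pg P x + ereal (lam \<bullet> Amat P x) - hconj P lam"

definition Dual :: "problem \<Rightarrow> fvec \<times> fvec \<Rightarrow> ereal"
  where "Dual P lam = (INF x\<in>Rx P. Lagr P x lam)"

definition primal_optimal :: "problem \<Rightarrow> fvec \<Rightarrow> bool"
  where "primal_optimal P x \<longleftrightarrow> is_arg_min (Fobj P) (\<lambda>y. y \<in> feasible P) x"

definition dual_optimal :: "problem \<Rightarrow> fvec \<times> fvec \<Rightarrow> bool"
  where "dual_optimal P lam \<longleftrightarrow> is_arg_max (Dual P) (\<lambda>v. v \<in> Rd P) lam"

definition standing_assumptions :: "problem \<Rightarrow> real \<Rightarrow> bool"
  where "standing_assumptions P Lh \<longleftrightarrow>
    proper_convex_closed (dimx P) (pg P) \<and>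
    proper_convex_closed (dim1 P) (\<lambda>u. ereal (ph1 P u)) \<and>
    Lh-lipschitz_on (Rn (dim1 P)) (ph1 P) \<and>
    pK P \<subseteq> Rn (dim2 P) \<and> pK P \<noteq> {} \<and> closed (pK P) \<and> convex (pK P) \<and>
    convex_fun (dimx P) (pf P) \<and>
    differentiable_around (dimx P) (pf P) (domg P) \<and>
    (\<exists>x lam. primal_optimal P x \<and> dual_optimal P lam \<and>
       x \<in> domg P \<and> lam \<in> domhconj P \<and> A2 P x \<in> pK P \<and>
       Fobj P x = Lagr P x lam \<and> Lagr P x lam = Dual P lam)"

definition smooth_obj ::
    "problem \<Rightarrow> fvec \<times> fvec \<Rightarrow> fvec \<times> fvec \<Rightarrow> real \<Rightarrow> fvec \<times> fvec \<Rightarrow> ereal"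
  where "smooth_obj P u lam \<beta> v =
    ereal (v \<bullet> u) - hconj P v - ereal (\<beta> / 2 * (norm (v - lam))\<^sup>2)"

definition hsmooth :: "problem \<Rightarrow> fvec \<times> fvec \<Rightarrow> fvec \<times> fvec \<Rightarrow> real \<Rightarrow> ereal"
  where "hsmooth P u lam \<beta> = (SUP v\<in>Rd P. smooth_obj P u lam \<beta> v)"

definition Lam :: "problem \<Rightarrow> fvec \<times> fvec \<Rightarrow> fvec \<times> fvec \<Rightarrow> real \<Rightarrow> fvec \<times> fvec"
  where "Lam P u lam \<beta> = arg_max (smooth_obj P u lam \<beta>) (\<lambda>v. v \<in> Rd P)"

definition Hobj :: "problem \<Rightarrow> fvec \<Rightarrow> fvec \<times> fvec \<Rightarrow> real \<Rightarrow> fvec \<Rightarrow> ereal"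
  where "Hobj P y lam \<beta> x =
    pf P x + pg P x + hsmooth P (Amat P x) lam \<beta> + ereal (\<beta> / 2 * (norm (x - y))\<^sup>2)"

definition Hmin :: "problem \<Rightarrow> fvec \<Rightarrow> fvec \<times> fvec \<Rightarrow> real \<Rightarrow> ereal"
  where "Hmin P y lam \<beta> = (INF x\<in>Rx P. Hobj P y lam \<beta> x)"


text \<open>\<open>bregman n \<xi> y x\<close> only makes sense where \<open>\<xi>\<close> has a gradient at \<open>x\<close>, so the
  solvability requirement is restricted to such points \<open>x\<close> of the domain of \<open>\<xi>\<close>.\<close>

definition relatively_smooth :: "problem \<Rightarrow> (fvec \<Rightarrow> ereal) \<Rightarrow> real \<Rightarrow> real \<Rightarrow> bool"
  where "relatively_smooth P \<xi> \<mu> Lf \<longleftrightarrow> (let n = dimx P in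
    convex_fun n \<xi> \<and> differentiable_around n \<xi> (domg P) \<and> 0 < \<mu> \<and> \<mu> < Lf \<and>
    (\<forall>x\<in>domg P. \<forall>y\<in>domg P.
       ereal \<mu> * bregman n \<xi> y x \<le> bregman n (pf P) y x \<and>
       bregman n (pf P) y x \<le> ereal Lf * bregman n \<xi> y x) \<and>
    (\<forall>\<alpha>>0. \<forall>\<beta>>0. \<forall>x\<in>edom n \<xi>. \<forall>x'\<in>Rn n. (\<exists>v. has_gradient n \<xi> x v) \<longrightarrow>
       (\<exists>y. is_arg_min
          (\<lambda>y. pg P y + ereal (\<beta> / 2 * (norm (y - x'))\<^sup>2) + ereal \<alpha> * bregman n \<xi> y x)
          (\<lambda>y. y \<in> Rn n) y)))"

text \<open>One step on \<open>Hobj P y lam \<beta>\<close>, with smooth part \<open>f + hsmooth (Amat P \<cdot>)\<close> and nonsmooth part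
  \<open>g + \<beta>/2 \<parallel>\<cdot> - y\<parallel>\<^sup>2\<close>. The constant \<open>max (\<parallel>A\<parallel>\<^sup>2/\<beta>) Lf\<close> is the
  smoothness constant of the smooth part relative to the reference function: the
  gradient of \<open>hsmooth\<close> in its first argument is \<open>1/\<beta>\<close>-Lipschitz.\<close>

definition bpg_step ::
    "problem \<Rightarrow> (fvec \<Rightarrow> ereal) \<Rightarrow> real \<Rightarrow> fvec \<Rightarrow> fvec \<times> fvec \<Rightarrow> real \<Rightarrow> fvec \<Rightarrow> fvec"
  where "bpg_step P \<xi> Lf y lam \<beta> x = (let n = dimx P in
    arg_min
      (\<lambda>z. ereal (grad n (\<lambda>w. pf P w + hsmooth P (Amat P w) lam \<beta>) x \<bullet> (z - x))
         + (pg P z + ereal (\<beta> / 2 * (norm (z - y))\<^sup>2))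
         + ereal (max ((normA P)\<^sup>2 / \<beta>) Lf)
           * bregman n (\<lambda>w. \<xi> w + ereal ((norm w)\<^sup>2 / 2)) z x)
      (\<lambda>z. z \<in> Rn n))"

definition bpg ::
    "problem \<Rightarrow> (fvec \<Rightarrow> ereal) \<Rightarrow> real \<Rightarrow> fvec \<Rightarrow> nat \<Rightarrow> fvec \<Rightarrow> fvec \<times> fvec \<Rightarrow> real \<Rightarrow> fvec"
  where "bpg P \<xi> Lf x k y lam \<beta> = (bpg_step P \<xi> Lf y lam \<beta> ^^ k) x"


text \<open>\<open>prev x' x s\<close> is the iterate with index \<open>s - 1\<close>, where \<open>x'\<close> has index \<open>-1\<close>.\<close>

definition prev :: "fvec \<Rightarrow> (nat \<Rightarrow> fvec) \<Rightarrow> nat \<Rightarrow> fvec"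
  where "prev x' x s = (case s of 0 \<Rightarrow> x' | Suc t \<Rightarrow> x t)"

definition Mterm ::
    "problem \<Rightarrow> real \<Rightarrow> (nat \<Rightarrow> real) \<Rightarrow> fvec \<Rightarrow> (nat \<Rightarrow> fvec) \<Rightarrow> (nat \<Rightarrow> fvec \<times> fvec) \<Rightarrow> nat \<Rightarrow> real"
  where "Mterm P Lh \<beta> x' x lam s =
    \<beta> s * (norm (lam (Suc s) - lam s))\<^sup>2
    + (\<beta> s - \<beta> (Suc s)) / 2
      * (norm (Lam P (Amat P (x s)) (lam (Suc s)) (\<beta> (Suc s)) - lam (Suc s)))\<^sup>2
    + (\<beta> s)\<^sup>2 / (2 * \<beta> (Suc s) - \<beta> s) * (norm (prev x' x s - x s))\<^sup>2
    + norm (lam (Suc s) - lam s)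
      * sqrt (((\<beta> s + \<beta> (Suc s)) * Lh
               + norm (\<beta> s *\<^sub>R fst (lam s) - \<beta> (Suc s) *\<^sub>R fst (lam (Suc s))))\<^sup>2
              + (norm (\<beta> s *\<^sub>R snd (lam s) - \<beta> (Suc s) *\<^sub>R snd (lam (Suc s))))\<^sup>2)"

definition ipalm_run ::
    "problem \<Rightarrow> (fvec \<Rightarrow> ereal) \<Rightarrow> real \<Rightarrow> real \<Rightarrow> (nat \<Rightarrow> real) \<Rightarrow> (nat \<Rightarrow> real) \<Rightarrow> nat \<Rightarrow> (nat \<Rightarrow> real) \<Rightarrow>
     fvec \<Rightarrow> fvec \<times> fvec \<Rightarrow> (nat \<Rightarrow> fvec) \<Rightarrow> (nat \<Rightarrow> fvec \<times> fvec) \<Rightarrow> (nat \<Rightarrow> nat) \<Rightarrow> bool"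
  where "ipalm_run P \<xi> Lf Lh \<beta> \<epsilon> m0 K x' lam0 x lam m \<longleftrightarrow>
    m 0 = m0 \<and> lam 0 = lam0 \<and>
    x 0 = bpg P \<xi> Lf x' m0 x' lam0 (\<beta> 0) \<and>
    Hobj P x' lam0 (\<beta> 0) (x 0) - Hmin P x' lam0 (\<beta> 0) \<le> ereal (\<epsilon> 0) \<and>
    (\<forall>s. lam (Suc s) = Lam P (Amat P (x s)) (lam s) (\<beta> s) \<and>
         m (Suc s) = (LEAST k. 0 < k \<and>
            2 * \<epsilon> s + Mterm P Lh \<beta> x' x lam s
              \<le> 2 powi \<lfloor>real k / K (Suc s)\<rfloor> * \<epsilon> (Suc s) / 2) \<and>
         x (Suc s) = bpg P \<xi> Lf (x s) (m (Suc s)) (x s) (lam (Suc s)) (\<beta> (Suc s)))"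

definition inner_guarantee ::
    "problem \<Rightarrow> (fvec \<Rightarrow> ereal) \<Rightarrow> real \<Rightarrow> (nat \<Rightarrow> real) \<Rightarrow> (nat \<Rightarrow> real) \<Rightarrow>
     fvec \<Rightarrow> (nat \<Rightarrow> fvec) \<Rightarrow> (nat \<Rightarrow> fvec \<times> fvec) \<Rightarrow> bool"
  where "inner_guarantee P \<xi> Lf \<beta> K x' x lam \<longleftrightarrow>
    (\<forall>s. \<forall>z\<in>domg P. \<forall>k. let y = prev x' x s in
       Hobj P y (lam s) (\<beta> s) (bpg P \<xi> Lf z k y (lam s) (\<beta> s)) - Hmin P y (lam s) (\<beta> s)
       \<le> ereal (2 powi (- \<lfloor>real k / K s\<rfloor>))
         * (Hobj P y (lam s) (\<beta> s) z - Hmin P y (lam s) (\<beta> s)))"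

definition c0_const ::
    "real \<Rightarrow> real \<Rightarrow> real \<Rightarrow> real \<Rightarrow> fvec \<Rightarrow> fvec \<times> fvec \<Rightarrow> fvec \<Rightarrow> fvec \<times> fvec \<Rightarrow> real"
  where "c0_const \<rho> \<eta> \<beta>0 \<epsilon>0 x' lam0 xopt lamopt =
    2 * (norm ((x', lam0) - (xopt, lamopt)) + 2 * sqrt (\<epsilon>0 / \<beta>0) / (1 - sqrt (\<eta> / \<rho>)))\<^sup>2
    + 2 * (norm lamopt)\<^sup>2 + 2 * (norm xopt)\<^sup>2"

definition c1_const :: "real \<Rightarrow> real \<Rightarrow> real \<Rightarrow> real \<Rightarrow> fvec \<times> fvec \<Rightarrow> real"
  where "c1_const \<beta>0 \<epsilon>0 Lh c0 lamopt =
    max (\<epsilon>0 + 2 * Lh\<^sup>2 * \<beta>0 + c0 * \<beta>0)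
        (max (\<beta>0 * norm (snd lamopt) * sqrt c0) (\<beta>0 * sqrt c0))"

definition c2_const :: "real \<Rightarrow> real \<Rightarrow> real \<Rightarrow> real \<Rightarrow> real \<Rightarrow> real \<Rightarrow> real"
  where "c2_const \<rho> \<eta> \<beta>0 \<epsilon>0 Lh c0 =
    log 2 (4 / \<eta> + 2 * \<beta>0 * ((11 + 2 / \<rho>\<^sup>2) * (Lh\<^sup>2 + 4 * c0) + 4 / (2 * \<rho> - 1) * c0)
                   / (\<epsilon>0 * \<eta>)) + 1"


text \<open>Integrability and finiteness are demanded because the library integral of a
  non-integrable function, and \<open>real_of_ereal \<infinity>\<close>, are \<open>0\<close>.\<close>

definition mean_le :: "'w measure \<Rightarrow> ('w \<Rightarrow> real) \<Rightarrow> real \<Rightarrow> bool"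
  where "mean_le M X b \<longleftrightarrow> integrable M X \<and> integral\<^sup>L M X \<le> b"

definition accurate :: "'w measure \<Rightarrow> problem \<Rightarrow> ('w \<Rightarrow> fvec) \<Rightarrow> real \<Rightarrow> bool"
  where "accurate M P x \<epsilon> \<longleftrightarrow>
    (\<forall>\<omega>\<in>space M. \<bar>Fobj P (x \<omega>) - Fstar P\<bar> \<noteq> \<infinity>) \<and>
    integrable M (\<lambda>\<omega>. real_of_ereal (Fobj P (x \<omega>) - Fstar P)) \<and>
    \<bar>integral\<^sup>L M (\<lambda>\<omega>. real_of_ereal (Fobj P (x \<omega>) - Fstar P))\<bar> \<le> \<epsilon> \<and>
    mean_le M (\<lambda>\<omega>. infdist (A2 P (x \<omega>)) (pK P)) \<epsilon>"

definition reached_within ::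
    "'w measure \<Rightarrow> problem \<Rightarrow> (nat \<Rightarrow> 'w \<Rightarrow> fvec) \<Rightarrow> (nat \<Rightarrow> 'w \<Rightarrow> nat) \<Rightarrow> real \<Rightarrow> real \<Rightarrow> bool"
  where "reached_within M P x m \<epsilon> b \<longleftrightarrow>
    (\<exists>s. accurate M P (x s) \<epsilon> \<and>
         (\<forall>t\<le>s. integrable M (\<lambda>\<omega>. real (m t \<omega>))) \<and>
         (\<Sum>t\<le>s. integral\<^sup>L M (\<lambda>\<omega>. real (m t \<omega>))) \<le> b)"

end

theory Submission
  imports Defs
begin

text \<open>
  Stage \<open>s\<close> of the algorithm minimizes \<open>H\<^sub>s(x) = max\<^sub>v S\<^sub>s(x, v)\<close> approximately, where
  \<open>S\<^sub>s(x, v) = L(x; v) + \<beta>\<^sub>s/2 \<parallel>x - x\<^sup>s\<^sup>-\<^sup>1\<parallel>\<^sup>2 - \<beta>\<^sub>s/2 \<parallel>v - \<lambda>\<^sup>s\<parallel>\<^sup>2\<close> is strongly convex-concave. So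
  \<open>(x\<^sup>s, \<lambda>\<^sup>s\<^sup>+\<^sup>1)\<close> is an inexact proximal point step for the saddle problem of the Lagrangian \<open>L\<close>, and the
  proof has four parts.

  Distance (\<open>quasi_fejer\<close>, \<open>distance_to_saddle\<close>). An \<open>\<epsilon>\<^sub>s\<close>-accurate step moves away from a saddle point
  by at most a multiple of \<open>sqrt (\<epsilon>\<^sub>s / \<beta>\<^sub>s)\<close>. These errors form a geometric series since \<open>\<eta> < \<rho>\<close>, so all
  iterates stay in a ball whose radius \<open>R\<close> is controlled by \<open>c\<^sub>1\<close> and \<open>\<beta>\<^sub>0\<close>.

  Accuracy (\<open>accuracy_of_near_min\<close>, \<open>stage_accuracy\<close>). \<open>A x\<^sup>s\<close> is at distance
  \<open>\<beta>\<^sub>s \<parallel>\<lambda>\<^sup>s\<^sup>+\<^sup>1 - \<lambda>\<^sup>s\<parallel>\<close> from the domain of \<open>h\<close>; hence infeasibility and objective error of \<open>x\<^sup>s\<close> are at most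
  \<open>Q \<beta>\<^sub>s\<close>, with \<open>Q\<close> depending on \<open>R\<close> and \<open>\<epsilon>\<^sub>0 / \<beta>\<^sub>0\<close> only.

  Warm start (\<open>warm_start_gap\<close>, \<open>near_min_run\<close>, \<open>inner_iterations_bound\<close>). The gap of \<open>x\<^sup>s\<close> in stage
  \<open>s + 1\<close> is at most \<open>2 \<epsilon>\<^sub>s + M\<^sub>s\<close>, so the prescribed number of inner iterations keeps the accuracy
  \<open>\<epsilon>\<^sub>s\<^sub>+\<^sub>1\<close>. Moreover \<open>M\<^sub>s = O(\<beta>\<^sub>s)\<close>, hence \<open>m\<^sub>s\<^sub>+\<^sub>1 = O(s K\<^sub>s\<^sub>+\<^sub>1)\<close>.

  Counting (\<open>first_accurate_stage\<close>, \<open>stage_count_absorbed\<close>). Accuracy \<open>\<epsilon>\<close> is reached at a stage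
  \<open>s = O(log (1/\<epsilon>))\<close> with \<open>\<beta>\<^sub>s\<close> of the order of \<open>\<epsilon>\<close>. There \<open>K\<^sub>s\<close> is of order
  \<open>a / (\<beta>\<^sub>s min(\<mu>\<^sub>g, \<mu>))\<close>, or \<open>a / \<beta>\<^sub>s\<^sup>2\<close> if the minimum is zero, where \<open>a = max (\<parallel>A\<parallel>\<^sup>2) (L\<^sub>f \<beta>\<^sub>0)\<close>.

  Two devices keep \<open>\<parallel>A\<parallel>\<close> and the dimensions out of the constants, and avoid exact minimizers of \<open>H\<^sub>s\<close>:
  the convexity of \<open>f + g\<close> is only used along segments between points of \<open>domg P\<close> (\<open>H_segment\<close>), and the smoothed
  term is always represented by the multiplier at the point in question. The existence of this
  multiplier (\<open>Lam_properties\<close>) is the only place where compactness is needed.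
\<close>

section \<open>Finite-dimensional subspaces\<close>

lemma subspace_Rn: "subspace (Rn n)"
  by (auto simp: subspace_def Rn_def)

lemma Rn_add: "u \<in> Rn n \<Longrightarrow> v \<in> Rn n \<Longrightarrow> u + v \<in> Rn n"
  and Rn_diff: "u \<in> Rn n \<Longrightarrow> v \<in> Rn n \<Longrightarrow> u - v \<in> Rn n"
  and Rn_scale: "u \<in> Rn n \<Longrightarrow> c *\<^sub>R u \<in> Rn n"
  by (auto simp: Rn_def)

lift_definition axis_vec :: "nat \<Rightarrow> fvec" is "\<lambda>i j. if j = i then 1 else 0"
  by simp

lemma axis_vec_inner: "axis_vec i \<bullet> v = coord v i"
  by (subst inner_fvec_superset[of "{i}"]) (auto simp: axis_vec.rep_eq split: if_splits)

lemma norm_axis_vec: "norm (axis_vec i) = 1"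
  by (simp add: norm_eq_sqrt_inner axis_vec_inner axis_vec.rep_eq)

lemma abs_coord_le_norm: "\<bar>coord v i\<bar> \<le> norm v"
  using Cauchy_Schwarz_ineq2[of "axis_vec i" v] by (simp add: axis_vec_inner norm_axis_vec)

lemma closed_Rn: "closed (Rn n)"
proof -
  have "Rn n = (\<Inter>i\<in>{n..}. {v. axis_vec i \<bullet> v = 0})"
    by (auto simp: Rn_def axis_vec_inner)
  moreover have "closed {v. axis_vec i \<bullet> v = 0}" for i
    by (intro closed_Collect_eq continuous_intros)
  ultimately show ?thesis by auto
qed

text \<open>
  \<open>fvec\<close> is infinite-dimensional, so compactness has to be won inside each \<open>Rn n\<close>: the box in
  \<open>Rn (Suc n)\<close> is a continuous image of the box in \<open>Rn n\<close> times an interval.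
\<close>

lemma compact_box_Rn: "compact {v \<in> Rn n. \<forall>i. \<bar>coord v i\<bar> \<le> r}"
proof (cases "0 \<le> r")
  case True
  show ?thesis
  proof (induction n)
    case 0
    have "{v \<in> Rn 0. \<forall>i. \<bar>coord v i\<bar> \<le> r} = {0}"
      using True by (auto simp: Rn_def coord_inject[symmetric] fun_eq_iff)
    then show ?case by simp
  next
    case (Suc n)
    let ?B = "\<lambda>n. {v \<in> Rn n. \<forall>i. \<bar>coord v i\<bar> \<le> r}"
    let ?\<phi> = "\<lambda>p. fst p + snd p *\<^sub>R axis_vec n"
    have "compact (?\<phi> ` (?B n \<times> {-r..r}))"
      using Suc by (intro compact_continuous_image compact_Times continuous_intros) auto
    moreover have "?\<phi> ` (?B n \<times> {-r..r}) = ?B (Suc n)"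
    proof (intro set_eqI iffI)
      fix w assume "w \<in> ?\<phi> ` (?B n \<times> {-r..r})"
      then show "w \<in> ?B (Suc n)"
        by (auto simp: Rn_def axis_vec.rep_eq)
    next
      fix w assume w: "w \<in> ?B (Suc n)"
      let ?v = "w - coord w n *\<^sub>R axis_vec n"
      have "w = ?\<phi> (?v, coord w n)" by simp
      moreover have "?v \<in> ?B n" "coord w n \<in> {-r..r}"
        using w True by (auto simp: Rn_def axis_vec.rep_eq abs_le_iff Suc_le_eq minus_le_iff)
      ultimately show "w \<in> ?\<phi> ` (?B n \<times> {-r..r})" by blast
    qed
    ultimately show ?case by simp
  qed
next
  case False
  then have "{v \<in> Rn n. \<forall>i. \<bar>coord v i\<bar> \<le> r} = {}"
    using order_trans[OF abs_ge_zero] by auto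
  then show ?thesis by (metis compact_empty)
qed

lemma compact_Rn_cball:
  assumes "closed S" and "S \<subseteq> Rn n \<times> Rn k"
  shows "compact (S \<inter> cball a R)"
proof -
  let ?B = "\<lambda>n. {v \<in> Rn n. \<forall>i. \<bar>coord v i\<bar> \<le> norm a + R}"
  have "S \<inter> cball a R \<subseteq> ?B n \<times> ?B k"
  proof
    fix w assume w: "w \<in> S \<inter> cball a R"
    then have "norm w \<le> norm a + R"
      using norm_triangle_sub[of w a] by (auto simp: dist_norm norm_minus_commute)
    then have "norm (fst w) \<le> norm a + R" "norm (snd w) \<le> norm a + R"
      using order_trans[OF norm_fst_le[of "fst w" "snd w"]] order_trans[OF norm_snd_le[of "snd w" "fst w"]]
      by simp_all
    then have "\<bar>coord (fst w) i\<bar> \<le> norm a + R" "\<bar>coord (snd w) i\<bar> \<le> norm a + R" for i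
      using order_trans[OF abs_coord_le_norm[of "fst w" i]] order_trans[OF abs_coord_le_norm[of "snd w" i]]
      by simp_all
    moreover have "w \<in> Rn n \<times> Rn k" using w assms(2) by blast
    ultimately show "w \<in> ?B n \<times> ?B k" by (simp add: mem_Times_iff)
  qed
  moreover have "compact (?B n \<times> ?B k)"
    by (intro compact_Times compact_box_Rn)
  ultimately show ?thesis
    using compact_Int_closed[of "?B n \<times> ?B k" "S \<inter> cball a R"] closed_Int[OF assms(1) closed_cball]
    by (simp add: Int_absorb1)
qed

text \<open>
  Orthogonal projection onto \<open>Rn n\<close>. It preserves inner products with vectors of \<open>Rn n\<close>; in
  \<open>bpg_step_in_domg\<close> it brings the gradients, and with them the proximal centre, into \<open>Rn n\<close>.
\<close>

lift_definition trunc :: "nat \<Rightarrow> fvec \<Rightarrow> fvec" is "\<lambda>n v i. if i < n then v i else 0"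
  by (rule finite_subset[of _ "{..<n}" for n]) auto

lemma trunc_in_Rn: "trunc n v \<in> Rn n"
  by (simp add: Rn_def trunc.rep_eq)

lemma trunc_inner: "z \<in> Rn n \<Longrightarrow> trunc n v \<bullet> z = v \<bullet> z"
  by (subst (1 2) inner_fvec_superset[of "{..<n}"]) (auto simp: Rn_def trunc.rep_eq linorder_not_le[symmetric])

lemma Amat_in_Rd: "Amat P x \<in> Rd P"
  by (simp add: Amat_def A1_def A2_def Rn_def mat_vec.rep_eq)

lemma linear_mat_vec: "linear (mat_vec d n A)"
  by (intro linearI; simp add: coord_inject[symmetric] fun_eq_iff mat_vec.rep_eq
        sum.distrib sum_distrib_left algebra_simps)

lemma linear_Amat: "linear (Amat P)"
  by (intro linearI)
    (simp_all add: Amat_def A1_def A2_def linear_add[OF linear_mat_vec] linear_scale[OF linear_mat_vec])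

lemma nonpos_if_linear_le_quadratic:
  fixes X Y :: real
  assumes "\<And>t. 0 < t \<Longrightarrow> t < 1 \<Longrightarrow> t * X \<le> t\<^sup>2 * Y"
  shows "X \<le> 0"
proof (rule ccontr)
  assume "\<not> X \<le> 0"
  then have X: "0 < X" by simp
  define t where "t = X / (2 * (\<bar>Y\<bar> + X))"
  have t: "0 < t" "t < 1"
    using X by (auto simp: t_def divide_simps)
  have "X \<le> t * Y"
    using assms[OF t] t(1) by (simp add: power2_eq_square)
  also have "\<dots> \<le> t * (\<bar>Y\<bar> + X)"
    using t X by (intro mult_left_mono) auto
  finally have "X \<le> t * (\<bar>Y\<bar> + X)" .
  moreover have "\<bar>Y\<bar> + X \<noteq> 0" using X by linarith
  then have "t * (\<bar>Y\<bar> + X) = X / 2" unfolding t_def by (metis nonzero_divide_eq_eq divide_divide_eq_left)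
  ultimately show False using X by simp
qed

lemma norm_segment_sq:
  fixes a b c :: "'a::real_inner"
  shows "(norm ((1 - t) *\<^sub>R a + t *\<^sub>R b - c))\<^sup>2
    = (1 - t) * (norm (a - c))\<^sup>2 + t * (norm (b - c))\<^sup>2 - t * (1 - t) * (norm (a - b))\<^sup>2"
  by (simp add: power2_norm_eq_inner inner_simps inner_commute) algebra

text \<open>
  First-order optimality of a proximal point: moving from \<open>y\<close> a fraction \<open>t\<close> of the way to \<open>z\<close>
  changes the objective by a linear term in \<open>t\<close>, up to \<open>t\<^sup>2\<close>, and cannot decrease it.
\<close>

lemma prox_subgradient:
  fixes h :: "'a::real_inner \<Rightarrow> real"
  assumes "0 < \<beta>" and C: "convex C" and h: "convex_on C h" and "y \<in> C" "z \<in> C"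
    and min: "\<And>z. z \<in> C \<Longrightarrow> h y + (norm (y - p))\<^sup>2 / (2 * \<beta>) \<le> h z + (norm (z - p))\<^sup>2 / (2 * \<beta>)"
  shows "h y + ((p - y) /\<^sub>R \<beta>) \<bullet> (z - y) \<le> h z"
proof -
  define N where "N a = (norm a)\<^sup>2 / (2 * \<beta>)" for a :: 'a
  have "t * (h y - h z + N (y - p) - N (z - p) + N (y - z)) \<le> t\<^sup>2 * N (y - z)"
    if t: "0 < t" "t < 1" for t
  proof -
    let ?w = "(1 - t) *\<^sub>R y + t *\<^sub>R z"
    have w: "?w \<in> C" using C assms(4,5) t by (simp add: convex_alt)
    have "h y + N (y - p) \<le> h ?w + N (?w - p)" using min[OF w] by (simp add: N_def)
    also have "h ?w \<le> (1 - t) * h y + t * h z"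
      using convex_onD[OF h, of t y z] assms(4,5) t by simp
    finally have "h y + N (y - p) \<le> (1 - t) * h y + t * h z + N (?w - p)" by simp
    moreover have "N (?w - p) = (1 - t) * N (y - p) + t * N (z - p) - t * (1 - t) * N (y - z)"
      unfolding N_def norm_segment_sq by (simp add: diff_divide_distrib add_divide_distrib)
    ultimately show ?thesis
      by (simp add: right_diff_distrib distrib_left left_diff_distrib power2_eq_square)
  qed
  from nonpos_if_linear_le_quadratic[OF this]
  have "h y + (N (y - p) - N (z - p) + N (y - z)) \<le> h z" by simp
  moreover have "N (y - p) - N (z - p) + N (y - z) = ((p - y) /\<^sub>R \<beta>) \<bullet> (z - y)"
    using \<open>0 < \<beta>\<close>
    by (simp add: N_def power2_norm_eq_inner inner_simps inner_commute field_simps)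
  ultimately show ?thesis by simp
qed

lemma convex_funD:
  assumes "convex_fun n \<phi>" "x \<in> Rn n" "y \<in> Rn n" "\<phi> x \<le> ereal a" "\<phi> y \<le> ereal b" "0 \<le> t" "t \<le> 1"
  shows "\<phi> ((1 - t) *\<^sub>R x + t *\<^sub>R y) \<le> ereal ((1 - t) * a + t * b)"
proof -
  have "(x, a) \<in> epi n \<phi>" "(y, b) \<in> epi n \<phi>" "convex (epi n \<phi>)"
    using assms by (auto simp: epi_def convex_fun_def)
  from convexD_alt[OF this(3,1,2) assms(6,7)] show ?thesis by (simp add: epi_def)
qed

section \<open>Smoothing of the composite term and its multiplier map\<close>

locale composite_problem =
  fixes P :: problem and Lh :: real
  assumes standing: "standing_assumptions P Lh"
begin

abbreviation domh :: "(fvec \<times> fvec) set"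
  where "domh \<equiv> Rn (dim1 P) \<times> pK P"

abbreviation hval :: "fvec \<times> fvec \<Rightarrow> real"
  where "hval u \<equiv> ph1 P (fst u)"

lemma Lh_nonneg: "0 \<le> Lh"
  using standing by (auto simp: standing_assumptions_def lipschitz_on_def)

lemma K_sub: "pK P \<subseteq> Rn (dim2 P)" and K_ne: "pK P \<noteq> {}" and K_closed: "closed (pK P)"
  and K_convex: "convex (pK P)"
  using standing by (auto simp: standing_assumptions_def)

lemma h1_lipschitz:
  "a \<in> Rn (dim1 P) \<Longrightarrow> b \<in> Rn (dim1 P) \<Longrightarrow> ph1 P a \<le> ph1 P b + Lh * norm (a - b)"
proof -
  assume *: "a \<in> Rn (dim1 P)" "b \<in> Rn (dim1 P)"
  have "Lh-lipschitz_on (Rn (dim1 P)) (ph1 P)"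
    using standing by (simp add: standing_assumptions_def)
  from lipschitz_onD[OF this *] show ?thesis by (simp add: dist_norm abs_le_iff)
qed

lemma domh_convex: "convex domh"
  by (intro convex_Times subspace_imp_convex subspace_Rn K_convex)

lemma domh_closed: "closed domh"
  by (intro closed_Times closed_Rn K_closed)

lemma domh_sub: "domh \<subseteq> Rd P"
  using K_sub by auto

lemma hval_convex: "convex_on domh hval"
proof (rule convex_onI[OF _ domh_convex])
  fix t x y assume t: "0 < t" "t < (1::real)" and xy: "x \<in> domh" "y \<in> domh"
  have "convex_fun (dim1 P) (\<lambda>u. ereal (ph1 P u))"
    using standing by (simp add: standing_assumptions_def proper_convex_closed_def)
  from convex_funD[OF this, of "fst x" "fst y" "hval x" "hval y" t] t xy
  show "hval ((1 - t) *\<^sub>R x + t *\<^sub>R y) \<le> (1 - t) * hval x + t * hval y"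
    by auto
qed

lemma hval_continuous: "continuous_on domh hval"
proof -
  have "continuous_on (Rn (dim1 P)) (ph1 P)"
    using standing lipschitz_on_continuous_on by (auto simp: standing_assumptions_def)
  then show ?thesis
    by (rule continuous_on_compose2) (auto intro: continuous_intros)
qed

text \<open>
  The proximal objective attains its minimum: a Lipschitz function decreases at most linearly,
  so the quadratic penalty wins outside a large ball, and the ball meets \<open>domh\<close> in a compact set.
\<close>

lemma prox_exists:
  assumes "0 < \<beta>" and p: "p \<in> Rd P"
  obtains y where "y \<in> domh"
    and "\<And>z. z \<in> domh \<Longrightarrow> hval y + (norm (y - p))\<^sup>2 / (2 * \<beta>) \<le> hval z + (norm (z - p))\<^sup>2 / (2 * \<beta>)"
proof -
  let ?\<phi> = "\<lambda>z. hval z + (norm (z - p))\<^sup>2 / (2 * \<beta>)"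
  obtain k where "k \<in> pK P" using K_ne by blast
  then have y0: "(0, k) \<in> domh" by (simp add: Rn_def)
  define y0 where "y0 = ((0::fvec), k)"
  define d where "d = norm (y0 - p)"
  \<comment> \<open>\<open>d + 2 * \<beta> * Lh\<close> is the distance from \<open>p\<close> beyond which the objective exceeds its value at \<open>y0\<close>.\<close>
  define R where "R = d + 2 * \<beta> * Lh"
  have y0: "y0 \<in> domh" using y0 by (simp add: y0_def)
  let ?S = "domh \<inter> cball p R"
  have "compact ?S"
    by (rule compact_Rn_cball[OF domh_closed domh_sub])
  moreover have y0S: "y0 \<in> ?S"
    using y0 Lh_nonneg \<open>0 < \<beta>\<close> by (simp add: R_def d_def dist_norm norm_minus_commute)
  moreover have "continuous_on ?S ?\<phi>"
    using \<open>0 < \<beta>\<close> by (intro continuous_intros continuous_on_subset[OF hval_continuous]) auto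
  ultimately obtain y where y: "y \<in> ?S" "\<And>z. z \<in> ?S \<Longrightarrow> ?\<phi> y \<le> ?\<phi> z"
    using continuous_attains_inf[of ?S ?\<phi>] by blast
  have "?\<phi> y \<le> ?\<phi> z" if z: "z \<in> domh" for z
  proof (cases "z \<in> cball p R")
    case False
    define r where "r = norm (z - p)"
    have r: "R < r" using False by (simp add: r_def dist_norm norm_minus_commute)
    have d: "0 \<le> d" by (simp add: d_def)
    have "hval y0 \<le> hval z + Lh * norm (fst y0 - fst z)"
      using h1_lipschitz[of "fst y0" "fst z"] y0 z by auto
    also have "norm (fst y0 - fst z) \<le> norm (y0 - z)"
      by (metis fst_diff norm_fst_le prod.collapse)
    also have "norm (y0 - z) \<le> d + r"
      using norm_triangle_ineq4[of "y0 - p" "z - p"] by (simp add: d_def r_def)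
    finally have 1: "hval y0 \<le> hval z + Lh * (d + r)"
      using Lh_nonneg by (simp add: mult_left_mono)
    have "2 * \<beta> * Lh \<le> r - d" using r by (simp add: R_def)
    moreover have "0 \<le> r + d" using d by (simp add: r_def)
    ultimately have "2 * \<beta> * Lh * (r + d) \<le> (r - d) * (r + d)"
      by (rule mult_right_mono)
    then have "2 * \<beta> * (Lh * (d + r)) + d\<^sup>2 \<le> r\<^sup>2"
      by (simp add: algebra_simps power2_eq_square)
    then have "Lh * (d + r) \<le> (r\<^sup>2 - d\<^sup>2) / (2 * \<beta>)"
      using \<open>0 < \<beta>\<close> by (subst pos_le_divide_eq) (simp_all add: algebra_simps)
    then have "Lh * (d + r) + d\<^sup>2 / (2 * \<beta>) \<le> r\<^sup>2 / (2 * \<beta>)"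
      by (simp add: diff_divide_distrib)
    then have "?\<phi> y0 \<le> ?\<phi> z" using 1 by (simp add: d_def r_def)
    then show ?thesis using y(2)[OF y0S] by simp
  qed (use y(2) z in auto)
  with y(1) that show ?thesis by blast
qed

lemma hconj_ge: "z \<in> domh \<Longrightarrow> ereal (v \<bullet> z - hval z) \<le> hconj P v"
  unfolding hconj_def using domh_sub
  by (intro SUP_upper2[of z]) (auto simp: hsum_def)

lemma hconj_not_MInf: "hconj P v \<noteq> -\<infinity>"
proof -
  obtain k where "k \<in> pK P" using K_ne by blast
  then have "(0, k) \<in> domh" by (simp add: Rn_def)
  from hconj_ge[OF this, of v] show ?thesis by auto
qed

text \<open>
  Equality in the Fenchel-Young inequality at a subgradient.
\<close>

lemma hconj_at_subgradient:
  assumes "y \<in> domh" and "\<And>z. z \<in> domh \<Longrightarrow> hval y + v \<bullet> (z - y) \<le> hval z"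
  shows "hconj P v = ereal (v \<bullet> y - hval y)"
proof (rule antisym)
  show "hconj P v \<le> ereal (v \<bullet> y - hval y)"
    unfolding hconj_def
  proof (rule SUP_least)
    fix z assume "z \<in> Rd P"
    then show "ereal (v \<bullet> z) - hsum P z \<le> ereal (v \<bullet> y - hval y)"
      using assms(2)[of z] by (cases "snd z \<in> pK P") (auto simp: hsum_def mem_Times_iff inner_diff_right)
  qed
qed (rule hconj_ge[OF assms(1)])

definition hc :: "fvec \<times> fvec \<Rightarrow> real"
  where "hc v = real_of_ereal (hconj P v)"

lemma hconj_eq_hc: "v \<in> domhconj P \<Longrightarrow> hconj P v = ereal (hc v)"
  using hconj_not_MInf[of v] by (cases "hconj P v") (auto simp: hc_def domhconj_def)

lemma fenchel_young: "v \<in> domhconj P \<Longrightarrow> z \<in> domh \<Longrightarrow> v \<bullet> z - hval z \<le> hc v"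
  using hconj_ge[of z v] by (simp add: hconj_eq_hc)

text \<open>
  Moreau decomposition. If \<open>y\<close> is the proximal point of \<open>p = u + \<beta> l\<close> for \<open>h\<close>, then
  \<open>(p - y) / \<beta>\<close> is a subgradient of \<open>h\<close> at \<open>y\<close>; the Fenchel-Young inequality at \<open>y\<close>, with equality at
  this subgradient, says that the smoothing objective drops quadratically away from it. So it is
  the unique maximizer, and \<open>y = u - \<beta> (v - l)\<close> lies in the domain of \<open>h\<close>.
\<close>

lemma Lam_properties:
  assumes \<beta>: "0 < \<beta>" and u: "u \<in> Rd P" and l: "l \<in> Rd P"
  defines "v \<equiv> Lam P u l \<beta>"
  defines "y \<equiv> u - \<beta> *\<^sub>R (v - l)"
  shows Lam_in_dom: "v \<in> domhconj P"
    and prox_in_domh: "y \<in> domh"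
    and hc_Lam: "hc v = v \<bullet> y - hval y"
    and hsmooth_eq: "hsmooth P u l \<beta> = ereal (v \<bullet> u - hc v - \<beta> / 2 * (norm (v - l))\<^sup>2)"
proof -
  define p where "p = u + \<beta> *\<^sub>R l"
  have p: "p \<in> Rd P" using u l by (auto simp: p_def Rn_add Rn_scale mem_Times_iff)
  obtain y' where y': "y' \<in> domh"
    and min: "\<And>z. z \<in> domh \<Longrightarrow> hval y' + (norm (y' - p))\<^sup>2 / (2 * \<beta>) \<le> hval z + (norm (z - p))\<^sup>2 / (2 * \<beta>)"
    using prox_exists[OF \<beta> p] by blast
  define v' where "v' = (p - y') /\<^sub>R \<beta>"
  have v'Rd: "v' \<in> Rd P"
    using p y' domh_sub by (auto simp: v'_def mem_Times_iff Rn_diff Rn_scale)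
  have y'_eq: "y' = u - \<beta> *\<^sub>R (v' - l)"
    using \<beta> by (simp add: v'_def p_def algebra_simps)
  have sub: "hval y' + v' \<bullet> (z - y') \<le> hval z" if "z \<in> domh" for z
    unfolding v'_def by (rule prox_subgradient[OF \<beta> domh_convex hval_convex y' that min])
  have hc': "hconj P v' = ereal (v' \<bullet> y' - hval y')"
    by (rule hconj_at_subgradient[OF y' sub])
  then have v'dom: "v' \<in> domhconj P" using v'Rd by (simp add: domhconj_def)
  have hcv': "hc v' = v' \<bullet> y' - hval y'" using hc' by (simp add: hc_def)
  let ?m = "v' \<bullet> u - hc v' - \<beta> / 2 * (norm (v' - l))\<^sup>2"
  have obj': "smooth_obj P u l \<beta> v' = ereal ?m"
    by (simp add: smooth_obj_def hconj_eq_hc[OF v'dom])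
  have le: "smooth_obj P u l \<beta> w \<le> ereal (?m - \<beta> / 2 * (norm (w - v'))\<^sup>2)" if w: "w \<in> Rd P" for w
  proof (cases "hconj P w = \<infinity>")
    case False
    then have wdom: "w \<in> domhconj P" using w by (simp add: domhconj_def top.not_eq_extremum)
    have "w \<bullet> y' - hval y' \<le> hc w" by (rule fenchel_young[OF wdom y'])
    then have "w \<bullet> u - hc w - \<beta> / 2 * (norm (w - l))\<^sup>2 \<le> ?m - \<beta> / 2 * (norm (w - v'))\<^sup>2"
      unfolding hcv' y'_eq using \<beta>
      by (simp add: power2_norm_eq_inner inner_simps inner_commute algebra_simps)
    then show ?thesis by (simp add: smooth_obj_def hconj_eq_hc[OF wdom])
  qed (simp add: smooth_obj_def)
  have max': "is_arg_max (smooth_obj P u l \<beta>) (\<lambda>v. v \<in> Rd P) v'"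
    unfolding is_arg_max_def
  proof (intro conjI v'Rd notI)
    assume "\<exists>w. w \<in> Rd P \<and> smooth_obj P u l \<beta> v' < smooth_obj P u l \<beta> w"
    then obtain w where w: "w \<in> Rd P" "smooth_obj P u l \<beta> v' < smooth_obj P u l \<beta> w" by blast
    have "ereal ?m < ereal (?m - \<beta> / 2 * (norm (w - v'))\<^sup>2)"
      using order.strict_trans2[OF w(2) le[OF w(1)]] unfolding obj' .
    moreover have "0 \<le> \<beta> / 2 * (norm (w - v'))\<^sup>2" using \<beta> by simp
    ultimately show False by simp
  qed
  then have "is_arg_max (smooth_obj P u l \<beta>) (\<lambda>v. v \<in> Rd P) v"
    unfolding v_def Lam_def arg_max_def by (rule someI)
  then have v: "v \<in> Rd P" "\<not> smooth_obj P u l \<beta> v < smooth_obj P u l \<beta> v'"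
    using v'Rd by (auto simp: is_arg_max_def)
  have "ereal ?m \<le> ereal (?m - \<beta> / 2 * (norm (v - v'))\<^sup>2)"
    using order.trans[OF leI[OF v(2)] le[OF v(1)]] unfolding obj' .
  then have "\<beta> / 2 * (norm (v - v'))\<^sup>2 \<le> 0" by simp
  moreover have "0 \<le> \<beta> / 2 * (norm (v - v'))\<^sup>2" using \<beta> by simp
  ultimately have "\<beta> / 2 * (norm (v - v'))\<^sup>2 = 0" by linarith
  then have vv': "v = v'" using \<beta> by simp
  then have yy': "y = y'" by (simp add: y_def y'_eq)
  show "v \<in> domhconj P" "y \<in> domh" "hc v = v \<bullet> y - hval y"
    using v'dom y' hcv' by (simp_all add: vv' yy')
  show "hsmooth P u l \<beta> = ereal (v \<bullet> u - hc v - \<beta> / 2 * (norm (v - l))\<^sup>2)"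
    unfolding hsmooth_def vv'
  proof (rule antisym)
    show "(SUP v\<in>Rd P. smooth_obj P u l \<beta> v) \<le> ereal ?m"
    proof (rule SUP_least)
      fix w assume "w \<in> Rd P"
      from le[OF this] show "smooth_obj P u l \<beta> w \<le> ereal ?m"
        by (rule order_trans) (use \<beta> in simp)
    qed
    show "ereal ?m \<le> (SUP v\<in>Rd P. smooth_obj P u l \<beta> v)"
      unfolding obj'[symmetric] by (rule SUP_upper[OF v'Rd])
  qed
qed

text \<open>
  \<open>u - \<beta> (v - l)\<close> is a subgradient of the conjugate at \<open>v\<close>.
\<close>

lemma Lam_subgradient:
  assumes "0 < \<beta>" "u \<in> Rd P" "l \<in> Rd P" "w \<in> domhconj P"
  defines "v \<equiv> Lam P u l \<beta>"
  shows "w \<bullet> u - hc w \<le> v \<bullet> u - hc v + \<beta> * ((v - l) \<bullet> (w - v))"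
  using fenchel_young[OF assms(4) prox_in_domh[OF assms(1-3)]] hc_Lam[OF assms(1-3)]
  unfolding v_def[symmetric]
  by (simp add: inner_simps inner_commute algebra_simps)

text \<open>
  The first block of the multiplier is a subgradient of the Lipschitz function \<open>h\<^sub>1\<close>; test it in its
  own direction.
\<close>

lemma norm_fst_Lam_le:
  assumes "0 < \<beta>" "u \<in> Rd P" "l \<in> Rd P"
  shows "norm (fst (Lam P u l \<beta>)) \<le> Lh"
proof -
  define v where "v = Lam P u l \<beta>"
  define y where "y = u - \<beta> *\<^sub>R (v - l)"
  have v: "v \<in> domhconj P" and y: "y \<in> domh" and hc: "hc v = v \<bullet> y - hval y"
    using Lam_properties[OF assms] by (simp_all add: v_def y_def)
  have "(fst y + fst v, snd y) \<in> domh"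
    using v y by (auto simp: domhconj_def mem_Times_iff Rn_add)
  from fenchel_young[OF v this] have "(norm (fst v))\<^sup>2 \<le> ph1 P (fst y + fst v) - ph1 P (fst y)"
    using hc by (simp add: power2_norm_eq_inner inner_prod_def inner_add_right)
  also have "\<dots> \<le> Lh * norm (fst v)"
    using h1_lipschitz[of "fst y + fst v" "fst y"] v y by (auto simp: domhconj_def mem_Times_iff Rn_add)
  finally show ?thesis
    unfolding v_def[symmetric] using Lh_nonneg
    by (cases "fst v = 0") (auto simp: power2_eq_square)
qed

text \<open>
  In the second block the proximal map is the projection onto \<open>pK P\<close>, applied to \<open>snd u + \<beta> snd l\<close> and
  to \<open>snd u + \<beta>' snd l'\<close>. The claim is that the complement of a projection is nonexpansive.
\<close>

lemma norm_snd_Lam_diff_le: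
  assumes "0 < \<beta>" "u \<in> Rd P" "l \<in> Rd P" "0 < \<beta>'" "l' \<in> Rd P"
  shows "norm (\<beta> *\<^sub>R snd (Lam P u l \<beta> - l) - \<beta>' *\<^sub>R snd (Lam P u l' \<beta>' - l'))
     \<le> norm (\<beta> *\<^sub>R snd l - \<beta>' *\<^sub>R snd l')"
proof -
  have proj: "(v \<bullet> k) \<le> v \<bullet> snd y"
    if "0 < \<beta>" "l \<in> Rd P" "k \<in> pK P" "v = snd (Lam P u l \<beta>)" "y = u - \<beta> *\<^sub>R (Lam P u l \<beta> - l)"
    for \<beta> l k v y
  proof -
    note L = Lam_properties[OF that(1) assms(2) that(2), folded that(5)]
    have "(fst y, k) \<in> domh" using L(2) that(3) by (simp only: mem_Times_iff fst_conv snd_conv)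
    from fenchel_young[OF L(1) this] L(3) show ?thesis
      by (simp add: inner_prod_def that(4))
  qed
  define v v' where "v = snd (Lam P u l \<beta>)" and "v' = snd (Lam P u l' \<beta>')"
  define y y' where "y = u - \<beta> *\<^sub>R (Lam P u l \<beta> - l)" and "y' = u - \<beta>' *\<^sub>R (Lam P u l' \<beta>' - l')"
  have y: "snd y \<in> pK P" "snd y' \<in> pK P"
    using prox_in_domh[OF assms(1-3)] prox_in_domh[OF assms(4,2,5)] by (auto simp: y_def y'_def mem_Times_iff)
  define a where "a = \<beta> *\<^sub>R v - \<beta>' *\<^sub>R v'"
  define b where "b = \<beta> *\<^sub>R snd l - \<beta>' *\<^sub>R snd l'"
  have e: "snd y' - snd y = a - b"
    by (simp add: y_def y'_def a_def b_def v_def v'_def algebra_simps)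
  have "v \<bullet> (a - b) \<le> 0" "0 \<le> v' \<bullet> (a - b)"
    using proj[OF assms(1,3) y(2) v_def y_def] proj[OF assms(4,5) y(1) v'_def y'_def]
    unfolding e[symmetric] by (simp_all add: inner_diff_right)
  then have "a \<bullet> (a - b) \<le> 0"
    using assms(1,4) unfolding a_def inner_diff_left inner_scaleR_left
    by (smt (verit) mult_nonneg_nonneg mult_nonneg_nonpos)
  then have "(norm (a - b))\<^sup>2 \<le> - (b \<bullet> (a - b))"
    by (simp add: power2_norm_eq_inner inner_diff_left)
  also have "\<dots> \<le> norm b * norm (a - b)"
    using Cauchy_Schwarz_ineq2[of b "a - b"] by linarith
  finally have "norm (a - b) \<le> norm b"
    by (cases "a = b") (auto simp: power2_eq_square)
  then show ?thesis by (simp add: a_def b_def v_def v'_def algebra_simps)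
qed

text \<open>
  The bound does not depend on \<open>u\<close>: this is what lets the optimality gap of the next subproblem be
  estimated from the computed iterate alone, and it is the square root in \<open>Mterm\<close>.
\<close>

lemma Lam_shift_le:
  assumes "0 < \<beta>" "u \<in> Rd P" "l \<in> Rd P" "0 < \<beta>'" "l' \<in> Rd P"
  shows "norm (\<beta> *\<^sub>R (Lam P u l \<beta> - l) - \<beta>' *\<^sub>R (Lam P u l' \<beta>' - l'))
    \<le> sqrt (((\<beta> + \<beta>') * Lh + norm (\<beta> *\<^sub>R fst l - \<beta>' *\<^sub>R fst l'))\<^sup>2
        + (norm (\<beta> *\<^sub>R snd l - \<beta>' *\<^sub>R snd l'))\<^sup>2)"
    (is "norm ?w \<le> _")
proof -
  define a where "a = \<beta> *\<^sub>R fst (Lam P u l \<beta>) - \<beta>' *\<^sub>R fst (Lam P u l' \<beta>')"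
  have "norm a \<le> \<beta> * norm (fst (Lam P u l \<beta>)) + \<beta>' * norm (fst (Lam P u l' \<beta>'))"
    using norm_triangle_ineq4[of "\<beta> *\<^sub>R fst (Lam P u l \<beta>)" "\<beta>' *\<^sub>R fst (Lam P u l' \<beta>')"] assms
    by (simp add: a_def)
  also have "\<dots> \<le> \<beta> * Lh + \<beta>' * Lh"
    using assms norm_fst_Lam_le by (intro add_mono mult_left_mono) auto
  finally have a: "norm a \<le> (\<beta> + \<beta>') * Lh" by (simp add: algebra_simps)
  have "fst ?w = a - (\<beta> *\<^sub>R fst l - \<beta>' *\<^sub>R fst l')"
    by (simp add: a_def algebra_simps)
  then have 1: "norm (fst ?w) \<le> (\<beta> + \<beta>') * Lh + norm (\<beta> *\<^sub>R fst l - \<beta>' *\<^sub>R fst l')"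
    using norm_triangle_ineq4[of a "\<beta> *\<^sub>R fst l - \<beta>' *\<^sub>R fst l'"] a by simp
  have 2: "norm (snd ?w) \<le> norm (\<beta> *\<^sub>R snd l - \<beta>' *\<^sub>R snd l')"
    using norm_snd_Lam_diff_le[OF assms] by simp
  have "norm ?w = sqrt ((norm (fst ?w))\<^sup>2 + (norm (snd ?w))\<^sup>2)"
    by (simp add: norm_prod_def)
  also have "\<dots> \<le> sqrt (((\<beta> + \<beta>') * Lh + norm (\<beta> *\<^sub>R fst l - \<beta>' *\<^sub>R fst l'))\<^sup>2
        + (norm (\<beta> *\<^sub>R snd l - \<beta>' *\<^sub>R snd l'))\<^sup>2)"
    by (intro real_sqrt_le_mono add_mono power_mono 1 2) auto
  finally show ?thesis .
qed

end

section \<open>Near-minimizers of a subproblem\<close>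

lemma parallelogram_ge: "(norm (a - b :: 'a :: real_inner))\<^sup>2 / 2 \<le> (norm (v - a))\<^sup>2 + (norm (v - b))\<^sup>2"
proof -
  have "(norm (v - a))\<^sup>2 + (norm (v - b))\<^sup>2 - (norm (a - b))\<^sup>2 / 2 = (norm (2 *\<^sub>R v - a - b))\<^sup>2 / 2"
    by (simp add: power2_norm_eq_inner inner_simps inner_commute field_simps)
  then show ?thesis by (smt (verit) divide_nonneg_nonneg zero_le_power2)
qed

lemma young: "0 < c \<Longrightarrow> \<beta> * (a \<bullet> b) - c / 4 * (norm a)\<^sup>2 \<le> \<beta>\<^sup>2 / c * (norm (b :: 'a :: real_inner))\<^sup>2"
proof -
  assume c: "0 < c"
  define k where "k = 2 * \<beta> / c"
  have "0 \<le> c / 4 * (norm (a - k *\<^sub>R b))\<^sup>2" using c by simp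
  also have "(norm (a - k *\<^sub>R b))\<^sup>2 = (norm a)\<^sup>2 - 2 * k * (a \<bullet> b) + k\<^sup>2 * (norm b)\<^sup>2"
    by (simp add: power2_norm_eq_inner inner_simps inner_commute power2_eq_square[of k])
  also have "c / 4 * \<dots> = c / 4 * (norm a)\<^sup>2 - (c / 4 * (2 * k)) * (a \<bullet> b) + (c / 4 * k\<^sup>2) * (norm b)\<^sup>2"
    by (simp add: algebra_simps)
  also have "c / 4 * (2 * k) = \<beta>" using c by (simp add: k_def)
  also have "c / 4 * k\<^sup>2 = \<beta>\<^sup>2 / c" using c by (simp add: k_def power2_eq_square)
  finally show ?thesis by simp
qed

context composite_problem
begin

lemma pf_finite: "x \<in> domg P \<Longrightarrow> \<bar>pf P x\<bar> \<noteq> \<infinity>"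
  using standing by (fastforce simp: standing_assumptions_def differentiable_around_def has_gradient_def)

lemma pg_not_MInf: "x \<in> Rx P \<Longrightarrow> pg P x \<noteq> -\<infinity>"
  using standing by (auto simp: standing_assumptions_def proper_convex_closed_def convex_fun_def)

definition G :: "fvec \<Rightarrow> real"
  where "G x = real_of_ereal (pf P x) + real_of_ereal (pg P x)"

lemma pf_pg_finite:
  assumes "x \<in> domg P"
  shows "pf P x = ereal (real_of_ereal (pf P x))" "pg P x = ereal (real_of_ereal (pg P x))"
proof -
  have "\<bar>pg P x\<bar> \<noteq> \<infinity>" using assms pg_not_MInf[of x] by (auto simp: edom_def)
  then show "pf P x = ereal (real_of_ereal (pf P x))" "pg P x = ereal (real_of_ereal (pg P x))"
    using pf_finite[OF assms] by (simp_all add: ereal_real')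
qed

lemma fg_eq_G: "x \<in> domg P \<Longrightarrow> pf P x + pg P x = ereal (G x)"
  using pf_pg_finite[of x] unfolding G_def by (metis plus_ereal.simps(1))

lemma fg_outside: "x \<in> Rx P \<Longrightarrow> x \<notin> domg P \<Longrightarrow> pf P x + pg P x = \<infinity>"
  by (auto simp: edom_def)

lemma G_segment:
  assumes "x \<in> domg P" "z \<in> domg P" "0 \<le> t" "t \<le> 1"
  shows "(1 - t) *\<^sub>R x + t *\<^sub>R z \<in> domg P"
    and "G ((1 - t) *\<^sub>R x + t *\<^sub>R z) \<le> (1 - t) * G x + t * G z"
proof -
  let ?w = "(1 - t) *\<^sub>R x + t *\<^sub>R z"
  have x: "x \<in> Rx P" "z \<in> Rx P" using assms by (auto simp: edom_def)
  have cf: "convex_fun (dimx P) (pf P)" and cg: "convex_fun (dimx P) (pg P)"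
    using standing by (auto simp: standing_assumptions_def proper_convex_closed_def)
  note f = pf_pg_finite[OF assms(1)] pf_pg_finite[OF assms(2)]
  have g: "pg P ?w \<le> ereal ((1 - t) * real_of_ereal (pg P x) + t * real_of_ereal (pg P z))"
    by (rule convex_funD[OF cg x _ _ assms(3,4)]) (use f in auto)
  have f: "pf P ?w \<le> ereal ((1 - t) * real_of_ereal (pf P x) + t * real_of_ereal (pf P z))"
    by (rule convex_funD[OF cf x _ _ assms(3,4)]) (use f in auto)
  have "?w \<in> Rx P" using x by (intro Rn_add Rn_scale)
  then show w: "?w \<in> domg P" using g by (auto simp: edom_def)
  show "G ?w \<le> (1 - t) * G x + t * G z"
    using f g pf_pg_finite[OF w] unfolding G_def
    by (smt (verit, best) distrib_left ereal_less_eq(3))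
qed

text \<open>
  The saddle function of the subproblem, strongly convex in \<open>x\<close> and strongly concave in \<open>v\<close> with the
  same modulus \<open>\<beta>\<close>; maximizing over \<open>v\<close> gives \<open>Hobj\<close>. On \<open>domg P\<close> and \<open>domhconj P\<close> everything is
  finite, so from here on the analysis is carried out in the reals.
\<close>

definition S :: "fvec \<Rightarrow> fvec \<times> fvec \<Rightarrow> real \<Rightarrow> fvec \<Rightarrow> fvec \<times> fvec \<Rightarrow> real"
  where "S y l \<beta> x v = G x + v \<bullet> Amat P x - hc v - \<beta> / 2 * (norm (v - l))\<^sup>2 + \<beta> / 2 * (norm (x - y))\<^sup>2"

abbreviation Lx :: "fvec \<times> fvec \<Rightarrow> real \<Rightarrow> fvec \<Rightarrow> fvec \<times> fvec"
  where "Lx l \<beta> x \<equiv> Lam P (Amat P x) l \<beta>"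

definition H :: "fvec \<Rightarrow> fvec \<times> fvec \<Rightarrow> real \<Rightarrow> fvec \<Rightarrow> real"
  where "H y l \<beta> x = S y l \<beta> x (Lx l \<beta> x)"

definition near_min :: "fvec \<Rightarrow> fvec \<times> fvec \<Rightarrow> real \<Rightarrow> real \<Rightarrow> fvec \<Rightarrow> bool"
  where "near_min y l \<beta> \<delta> x \<longleftrightarrow> x \<in> domg P \<and> (\<forall>z\<in>domg P. H y l \<beta> x \<le> H y l \<beta> z + \<delta>)"

lemma Hobj_eq_H:
  assumes "0 < \<beta>" "l \<in> Rd P" "x \<in> domg P"
  shows "Hobj P y l \<beta> x = ereal (H y l \<beta> x)"
  by (simp add: Hobj_def fg_eq_G[OF assms(3)] hsmooth_eq[OF assms(1) Amat_in_Rd assms(2)] H_def S_def)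

lemma Hobj_outside:
  assumes "x \<in> Rx P" "x \<notin> domg P"
  shows "Hobj P y l \<beta> x = \<infinity>"
  by (simp add: Hobj_def fg_outside[OF assms])

lemma gap_le_iff_near_min:
  assumes "0 < \<beta>" "l \<in> Rd P" "x \<in> domg P"
  shows "Hobj P y l \<beta> x - Hmin P y l \<beta> \<le> ereal \<delta> \<longleftrightarrow> near_min y l \<beta> \<delta> x"
proof -
  let ?h = "ereal (H y l \<beta> x)"
  have "?h - Hmin P y l \<beta> \<le> ereal \<delta> \<longleftrightarrow> ereal (H y l \<beta> x - \<delta>) \<le> Hmin P y l \<beta>"
    by (cases "Hmin P y l \<beta>") (auto simp: algebra_simps)
  also have "\<dots> \<longleftrightarrow> (\<forall>z\<in>Rx P. ereal (H y l \<beta> x - \<delta>) \<le> Hobj P y l \<beta> z)"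
    by (simp add: Hmin_def le_INF_iff)
  also have "\<dots> \<longleftrightarrow> (\<forall>z\<in>domg P. H y l \<beta> x - \<delta> \<le> H y l \<beta> z)"
  proof -
    have "ereal (H y l \<beta> x - \<delta>) \<le> Hobj P y l \<beta> z
      \<longleftrightarrow> (z \<in> domg P \<longrightarrow> H y l \<beta> x - \<delta> \<le> H y l \<beta> z)" if "z \<in> Rx P" for z
      using that by (cases "z \<in> domg P") (simp_all add: Hobj_eq_H[OF assms(1,2)] Hobj_outside)
    moreover have "domg P \<subseteq> Rx P" by (auto simp: edom_def)
    ultimately show ?thesis by blast
  qed
  finally show ?thesis
    by (simp add: near_min_def assms(3) Hobj_eq_H[OF assms] algebra_simps)
qed

lemma S_le_H:
  assumes "0 < \<beta>" "l \<in> Rd P" "v \<in> domhconj P"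
  shows "S y l \<beta> x v + \<beta> / 2 * (norm (v - Lx l \<beta> x))\<^sup>2 \<le> H y l \<beta> x"
proof -
  let ?w = "Lx l \<beta> x"
  have "\<beta> / 2 * (norm (v - l))\<^sup>2
    = \<beta> / 2 * (norm (v - ?w))\<^sup>2 + \<beta> * ((?w - l) \<bullet> (v - ?w)) + \<beta> / 2 * (norm (?w - l))\<^sup>2"
    by (simp add: power2_norm_eq_inner inner_simps inner_commute algebra_simps)
  then show ?thesis
    using Lam_subgradient[OF assms(1) Amat_in_Rd[of P x] assms(2,3)] unfolding H_def S_def by linarith
qed

lemma S_segment:
  assumes "x \<in> domg P" "z \<in> domg P" "0 \<le> t" "t \<le> 1"
  shows "S y l \<beta> ((1 - t) *\<^sub>R x + t *\<^sub>R z) v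
    \<le> (1 - t) * S y l \<beta> x v + t * S y l \<beta> z v - t * (1 - t) * (\<beta> / 2 * (norm (x - z))\<^sup>2)"
proof -
  define w where "w = (1 - t) *\<^sub>R x + t *\<^sub>R z"
  define N where "N a = \<beta> / 2 * (norm a)\<^sup>2" for a :: fvec
  define c where "c = hc v + \<beta> / 2 * (norm (v - l))\<^sup>2"
  have S: "S y l \<beta> x v = G x + v \<bullet> Amat P x - c + N (x - y)" for x
    by (simp add: S_def N_def c_def)
  have "v \<bullet> Amat P w = (1 - t) * (v \<bullet> Amat P x) + t * (v \<bullet> Amat P z)"
    by (simp add: w_def linear_add[OF linear_Amat] linear_scale[OF linear_Amat] inner_add_right)
  moreover have "N (w - y) = (1 - t) * N (x - y) + t * N (z - y) - t * (1 - t) * N (x - z)"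
    unfolding N_def w_def norm_segment_sq by (simp add: field_simps)
  moreover have "G w \<le> (1 - t) * G x + t * G z"
    unfolding w_def by (rule G_segment(2)[OF assms])
  ultimately show ?thesis
    unfolding S w_def[symmetric] N_def[symmetric] by (simp add: algebra_simps)
qed

text \<open>
  The smoothed term is handled through the multiplier \<open>v\<close> of the point on the segment:
  \<open>S\<close> is strongly convex along the segment for this fixed \<open>v\<close>, and replacing the multiplier of the
  left end point by \<open>v\<close> gains a quadratic term. The norm of \<open>A\<close> never enters.
\<close>

lemma H_segment:
  assumes "0 < \<beta>" "l \<in> Rd P" "x \<in> domg P" "z \<in> domg P" "0 \<le> t" "t \<le> 1"
  obtains v where "v \<in> domhconj P"
    and "H y l \<beta> ((1 - t) *\<^sub>R x + t *\<^sub>R z)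
      \<le> (1 - t) * (H y l \<beta> x - \<beta> / 2 * (norm (v - Lx l \<beta> x))\<^sup>2)
        + t * S y l \<beta> z v - t * (1 - t) * (\<beta> / 2 * (norm (x - z))\<^sup>2)"
proof
  let ?v = "Lx l \<beta> ((1 - t) *\<^sub>R x + t *\<^sub>R z)"
  show v: "?v \<in> domhconj P" by (rule Lam_in_dom[OF assms(1) Amat_in_Rd assms(2)])
  have "(1 - t) * S y l \<beta> x ?v \<le> (1 - t) * (H y l \<beta> x - \<beta> / 2 * (norm (?v - Lx l \<beta> x))\<^sup>2)"
    using S_le_H[OF assms(1,2) v, of y x] assms(6) by (intro mult_left_mono) auto
  then show "H y l \<beta> ((1 - t) *\<^sub>R x + t *\<^sub>R z)
      \<le> (1 - t) * (H y l \<beta> x - \<beta> / 2 * (norm (?v - Lx l \<beta> x))\<^sup>2)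
        + t * S y l \<beta> z ?v - t * (1 - t) * (\<beta> / 2 * (norm (x - z))\<^sup>2)"
    using S_segment[OF assms(3-6), of y l \<beta> ?v] unfolding H_def[of y l \<beta> "_ + _"] by linarith
qed

text \<open>
  Two points with small optimality gaps are close, and so are their multipliers: their midpoint
  would otherwise have an objective value below the infimum.
\<close>

lemma gap_controls_distance:
  assumes "0 < \<beta>" "l \<in> Rd P" "near_min y l \<beta> \<delta> x" "z \<in> domg P"
  shows "\<beta> / 4 * ((norm (x - z))\<^sup>2 + (norm (Lx l \<beta> x - Lx l \<beta> z))\<^sup>2)
    \<le> H y l \<beta> z - H y l \<beta> x + 2 * \<delta>"
proof -
  have x: "x \<in> domg P" using assms(3) by (simp add: near_min_def)
  let ?w = "(1 - 1/2) *\<^sub>R x + (1/2::real) *\<^sub>R z"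
  obtain v where v: "v \<in> domhconj P"
    and le: "H y l \<beta> ?w
      \<le> (1 - 1/2) * (H y l \<beta> x - \<beta> / 2 * (norm (v - Lx l \<beta> x))\<^sup>2)
        + 1/2 * S y l \<beta> z v - 1/2 * (1 - 1/2) * (\<beta> / 2 * (norm (x - z))\<^sup>2)"
    using H_segment[OF assms(1,2) x assms(4), of "1/2"] by auto
  have "H y l \<beta> x \<le> H y l \<beta> ?w + \<delta>"
    using assms(3) G_segment(1)[OF x assms(4), of "1/2"] by (simp add: near_min_def)
  moreover have "S y l \<beta> z v + \<beta> / 2 * (norm (v - Lx l \<beta> z))\<^sup>2 \<le> H y l \<beta> z"
    by (rule S_le_H[OF assms(1,2) v])
  moreover have "\<beta> * ((norm (Lx l \<beta> x - Lx l \<beta> z))\<^sup>2 / 2)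
      \<le> \<beta> * ((norm (v - Lx l \<beta> x))\<^sup>2 + (norm (v - Lx l \<beta> z))\<^sup>2)"
    using assms(1) by (intro mult_left_mono parallelogram_ge) auto
  ultimately show ?thesis using le by (simp add: algebra_simps)
qed

text \<open>
  The smoothing is also the minimum over \<open>w\<close> of \<open>h (u - w) + l \<bullet> w + \<parallel>w\<parallel>\<^sup>2 / (2 \<beta>)\<close>, attained at
  \<open>w = \<beta> (v - l)\<close>. In this form a smaller \<open>\<beta>\<close> only increases it, and a change of \<open>l\<close> enters
  linearly; evaluating at the minimizer for the new parameters gives the claim.
\<close>

lemma smoothing_shift:
  assumes "0 < \<beta>'" "\<beta>' \<le> \<beta>" "l \<in> Rd P" "l' \<in> Rd P" "u \<in> Rd P"
  defines "v \<equiv> Lam P u l \<beta>" and "v' \<equiv> Lam P u l' \<beta>'"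
  shows "v \<bullet> u - hc v - \<beta> / 2 * (norm (v - l))\<^sup>2 + (l' - l) \<bullet> (\<beta>' *\<^sub>R (v' - l'))
    \<le> v' \<bullet> u - hc v' - \<beta>' / 2 * (norm (v' - l'))\<^sup>2"
proof -
  have \<beta>: "0 < \<beta>" using assms by simp
  define w w' where "w = v - l" and "w' = v' - l'"
  define y' where "y' = u - \<beta>' *\<^sub>R w'"
  have v: "v \<in> domhconj P" unfolding v_def by (rule Lam_in_dom[OF \<beta> assms(5,3)])
  have y': "y' \<in> domh" "hc v' = v' \<bullet> y' - hval y'"
    using prox_in_domh[OF assms(1,5,4)] hc_Lam[OF assms(1,5,4)] by (simp_all add: y'_def v'_def w'_def)
  have "v \<bullet> y' - hval y' \<le> hc v" by (rule fenchel_young[OF v y'(1)])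
  moreover have "0 \<le> (norm (\<beta>' *\<^sub>R w' - \<beta> *\<^sub>R w))\<^sup>2 / (2 * \<beta>) + \<beta>' * (1 - \<beta>' / \<beta>) / 2 * (norm w')\<^sup>2"
    using \<beta> assms(1,2) by simp
  moreover have "\<dots> = \<beta> / 2 * (norm w)\<^sup>2 + \<beta>' / 2 * (norm w')\<^sup>2 - \<beta>' * (w \<bullet> w')"
    using \<beta> by (simp add: power2_norm_eq_inner inner_simps inner_commute field_simps)
  moreover have "v' \<bullet> u - v' \<bullet> y' = \<beta>' * (l' \<bullet> w') + \<beta>' * (norm w')\<^sup>2"
    "v \<bullet> u - v \<bullet> y' = \<beta>' * (l \<bullet> w') + \<beta>' * (w \<bullet> w')"
    by (simp_all add: y'_def w_def w'_def power2_norm_eq_inner inner_simps algebra_simps)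
  moreover have "(l' - l) \<bullet> (\<beta>' *\<^sub>R w') = \<beta>' * (l' \<bullet> w') - \<beta>' * (l \<bullet> w')"
    by (simp add: inner_diff_left algebra_simps)
  ultimately show ?thesis
    unfolding w_def[symmetric] w'_def[symmetric] y'(2) by linarith
qed

text \<open>
  The last iterate is a good start for the next subproblem. At the iterate itself the two objectives
  differ by at most the first two summands of \<open>Mterm\<close>, by the subgradient inequality at \<open>l'\<close>. At any
  other point \<open>z\<close> the new objective can lie below the old one only through the change of the proximal
  term and of the multiplier. Apart from a quadratic term that \<open>\<beta> < 2 * \<beta>'\<close> keeps small, both effects
  are linear in the distance from \<open>(x, l')\<close> to \<open>z\<close> and its multiplier. The quadratic growth
  of \<open>gap_controls_distance\<close> absorbs them at the price of a second \<open>\<delta>\<close> and the last two summands.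
\<close>

lemma warm_start_gap:
  assumes \<beta>: "0 < \<beta>" "\<beta>' \<le> \<beta>" "\<beta> < 2 * \<beta>'" and l: "l \<in> Rd P" and x: "near_min y l \<beta> \<delta> x"
  defines "l' \<equiv> Lx l \<beta> x"
  shows "near_min x l' \<beta>' (2 * \<delta> + (\<beta> * (norm (l' - l))\<^sup>2
      + (\<beta> - \<beta>') / 2 * (norm (Lx l' \<beta>' x - l'))\<^sup>2
      + \<beta>\<^sup>2 / (2 * \<beta>' - \<beta>) * (norm (y - x))\<^sup>2
      + norm (l' - l) * sqrt (((\<beta> + \<beta>') * Lh + norm (\<beta> *\<^sub>R fst l - \<beta>' *\<^sub>R fst l'))\<^sup>2
        + (norm (\<beta> *\<^sub>R snd l - \<beta>' *\<^sub>R snd l'))\<^sup>2))) x"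
    (is "near_min _ _ _ (_ + (?T1 + ?T2 + ?T3 + _ * ?E)) _")
  unfolding near_min_def
proof (intro conjI ballI)
  show xd: "x \<in> domg P" using x by (simp add: near_min_def)
  fix z assume z: "z \<in> domg P"
  have \<beta>': "0 < \<beta>'" using \<beta> by linarith
  have l'd: "l' \<in> domhconj P" unfolding l'_def by (rule Lam_in_dom[OF \<beta>(1) Amat_in_Rd l])
  then have l': "l' \<in> Rd P" by (simp add: domhconj_def)
  define v where "v = Lx l' \<beta>' x"
  have v: "v \<in> domhconj P" unfolding v_def by (rule Lam_in_dom[OF \<beta>' Amat_in_Rd l'])
  define s where "s = Lx l \<beta> z"
  define s' where "s' = Lx l' \<beta>' z"
  define w where "w = \<beta> *\<^sub>R (s - l)"
  define w' where "w' = \<beta>' *\<^sub>R (s' - l')"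
  have "v \<bullet> Amat P x - hc v \<le> l' \<bullet> Amat P x - hc l' + \<beta> * ((l' - l) \<bullet> (v - l'))"
    using Lam_subgradient[OF \<beta>(1) Amat_in_Rd l v, of x] by (simp add: l'_def)
  moreover have "0 \<le> \<beta> / 2 * (norm ((l' - l) - (v - l')))\<^sup>2" using \<beta> by simp
  then have "\<beta> * ((l' - l) \<bullet> (v - l')) \<le> \<beta> / 2 * (norm (l' - l))\<^sup>2 + \<beta> / 2 * (norm (v - l'))\<^sup>2"
    by (simp add: power2_norm_eq_inner inner_simps inner_commute algebra_simps)
  ultimately have 1: "H x l' \<beta>' x \<le> H y l \<beta> x - \<beta> / 2 * (norm (x - y))\<^sup>2 + ?T1 + ?T2"
    unfolding H_def S_def v_def[symmetric] l'_def[symmetric] by (simp add: field_simps)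
  have "s \<bullet> Amat P z - hc s - \<beta> / 2 * (norm (s - l))\<^sup>2 + (l' - l) \<bullet> w'
      \<le> s' \<bullet> Amat P z - hc s' - \<beta>' / 2 * (norm (s' - l'))\<^sup>2"
    using smoothing_shift[OF \<beta>' \<beta>(2) l l' Amat_in_Rd[of P z]] by (simp add: s_def s'_def w'_def)
  then have 2: "H y l \<beta> z - \<beta> / 2 * (norm (z - y))\<^sup>2 + \<beta>' / 2 * (norm (z - x))\<^sup>2 + (l' - l) \<bullet> w'
      \<le> H x l' \<beta>' z"
    unfolding H_def S_def s_def[symmetric] s'_def[symmetric] by simp
  have "norm (w - w') \<le> ?E"
    using Lam_shift_le[OF \<beta>(1) Amat_in_Rd[of P z] l \<beta>' l'] by (simp add: w_def w'_def s_def s'_def)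
  then have "norm (l' - l) * norm (w - w') \<le> norm (l' - l) * ?E"
    by (rule mult_left_mono) simp
  then have "(l' - l) \<bullet> (w - w') \<le> norm (l' - l) * ?E"
    using norm_cauchy_schwarz[of "l' - l" "w - w'"] by linarith
  then have 3: "(l' - l) \<bullet> w - norm (l' - l) * ?E \<le> (l' - l) \<bullet> w'"
    by (simp add: inner_diff_right)
  have "0 \<le> \<beta> * (norm ((l' - l) + (1/2) *\<^sub>R (s - l')))\<^sup>2" using \<beta> by simp
  then have 4: "- (\<beta> / 4 * (norm (l' - s))\<^sup>2) \<le> (l' - l) \<bullet> w"
    unfolding w_def by (simp add: power2_norm_eq_inner inner_simps inner_commute field_simps)
  have 5: "\<beta> / 4 * ((norm (x - z))\<^sup>2 + (norm (l' - s))\<^sup>2) \<le> H y l \<beta> z - H y l \<beta> x + 2 * \<delta>"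
    unfolding l'_def s_def by (rule gap_controls_distance[OF \<beta>(1) l x z])
  have "\<beta> * ((z - x) \<bullet> (x - y)) - (2 * \<beta>' - \<beta>) / 4 * (norm (z - x))\<^sup>2 \<le> \<beta>\<^sup>2 / (2 * \<beta>' - \<beta>) * (norm (x - y))\<^sup>2"
    using \<beta> by (intro young) simp
  moreover have "\<beta> / 2 * (norm (z - y))\<^sup>2
      = \<beta> / 2 * (norm (z - x))\<^sup>2 + \<beta> * ((z - x) \<bullet> (x - y)) + \<beta> / 2 * (norm (x - y))\<^sup>2"
    by (simp add: power2_norm_eq_inner inner_simps inner_commute algebra_simps)
  moreover have "(2 * \<beta>' - \<beta>) / 4 * (norm (z - x))\<^sup>2
      = \<beta>' / 2 * (norm (z - x))\<^sup>2 - \<beta> / 4 * (norm (z - x))\<^sup>2"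
    by (simp add: field_simps)
  ultimately have "\<beta> / 2 * (norm (z - y))\<^sup>2 - \<beta> / 2 * (norm (x - y))\<^sup>2 - \<beta>' / 2 * (norm (z - x))\<^sup>2
      - \<beta> / 4 * (norm (x - z))\<^sup>2 \<le> ?T3"
    unfolding norm_minus_commute[of x z] norm_minus_commute[of y x] by linarith
  with 1 2 3 4 5 show "H x l' \<beta>' x \<le> H x l' \<beta>' z + (2 * \<delta> + (?T1 + ?T2 + ?T3 + norm (l' - l) * ?E))"
    by (simp add: distrib_left)
qed

end

section \<open>Distance to a saddle point, and accuracy\<close>

locale saddle_problem = composite_problem +
  fixes xo :: fvec and lo :: "fvec \<times> fvec"
  assumes xo_opt: "primal_optimal P xo" and lo_opt: "dual_optimal P lo"
begin

lemma optimal_in_dom: "xo \<in> domg P" "Amat P xo \<in> domh" "lo \<in> domhconj P"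
  and Fstar_eq: "Fstar P = ereal (G xo + ph1 P (A1 P xo))"
  and saddle_primal: "x \<in> domg P \<Longrightarrow> G xo + ph1 P (A1 P xo) \<le> G x + lo \<bullet> Amat P x - hc lo"
proof -
  obtain x1 l1 where o: "primal_optimal P x1" "dual_optimal P l1" "x1 \<in> domg P" "l1 \<in> domhconj P"
    "A2 P x1 \<in> pK P" "Fobj P x1 = Lagr P x1 l1" "Lagr P x1 l1 = Dual P l1"
    using standing unfolding standing_assumptions_def by blast
  have xo: "xo \<in> feasible P" and xoR: "xo \<in> Rx P"
    using xo_opt by (auto simp: primal_optimal_def is_arg_min_def feasible_def)
  have F: "Fobj P xo = Fobj P x1"
    using xo_opt o(1) unfolding primal_optimal_def is_arg_min_def by (meson linorder_neqE)
  have D: "Dual P lo = Dual P l1"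
    using lo_opt o(2) unfolding dual_optimal_def is_arg_max_def by (meson linorder_neqE)
  have F1: "Fobj P x1 = ereal (G x1 + ph1 P (A1 P x1))"
    by (simp add: Fobj_def fg_eq_G[OF o(3)])
  show xd: "xo \<in> domg P"
  proof (rule ccontr)
    assume "xo \<notin> domg P"
    then have "Fobj P xo = \<infinity>" by (simp add: Fobj_def fg_outside[OF xoR])
    with F F1 show False by simp
  qed
  have Fxo: "Fobj P xo = ereal (G xo + ph1 P (A1 P xo))"
    by (simp add: Fobj_def fg_eq_G[OF xd])
  show "Amat P xo \<in> domh"
    using xo Amat_in_Rd[of P xo] by (simp add: feasible_def Amat_def)
  have dual: "Dual P lo = ereal (G xo + ph1 P (A1 P xo))"
    using D o(6,7) F Fxo by simp
  have lR: "lo \<in> Rd P" using lo_opt by (simp add: dual_optimal_def is_arg_max_def)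
  have le: "ereal (G xo + ph1 P (A1 P xo)) \<le> Lagr P x lo" if "x \<in> Rx P" for x
    unfolding dual[symmetric] Dual_def by (rule INF_lower[OF that])
  show ld: "lo \<in> domhconj P"
  proof (rule ccontr)
    assume "lo \<notin> domhconj P"
    then have "hconj P lo = \<infinity>" using lR by (auto simp: domhconj_def)
    with le[OF xoR] show False by (simp add: Lagr_def fg_eq_G[OF xd])
  qed
  show "G xo + ph1 P (A1 P xo) \<le> G x + lo \<bullet> Amat P x - hc lo" if x: "x \<in> domg P"
  proof -
    have "x \<in> Rx P" using x by (simp add: edom_def)
    from le[OF this] show ?thesis by (simp add: Lagr_def fg_eq_G[OF x] hconj_eq_hc[OF ld])
  qed
  show "Fstar P = ereal (G xo + ph1 P (A1 P xo))"
    unfolding Fstar_def Fxo[symmetric]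
  proof (rule antisym)
    show "(INF x\<in>feasible P. Fobj P x) \<le> Fobj P xo" by (rule INF_lower[OF xo])
    show "Fobj P xo \<le> (INF x\<in>feasible P. Fobj P x)"
      using xo_opt by (intro INF_greatest) (auto simp: primal_optimal_def is_arg_min_def not_less)
  qed
qed

abbreviation Fs :: real
  where "Fs \<equiv> G xo + ph1 P (A1 P xo)"

lemma saddle_dual: "v \<in> domhconj P \<Longrightarrow> G xo + v \<bullet> Amat P xo - hc v \<le> Fs"
  using fenchel_young[of v "Amat P xo"] optimal_in_dom(2) by (simp add: Amat_def)

text \<open>
  An exact solution of the subproblem, with its multiplier, is the resolvent of the saddle operator at
  \<open>(y, l)\<close> and is at least as close to every saddle point as \<open>(y, l)\<close>. A near-minimizer \<open>x\<close> is
  compared with the points \<open>(1 - t) x + t xo\<close>; for \<open>t\<close> tending to zero this would be the exact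
  argument, and balancing \<open>t\<close> against \<open>\<delta> / t\<close> costs a multiple of \<open>sqrt (\<delta> / \<beta>)\<close>.
\<close>

lemma quasi_fejer:
  assumes \<beta>: "0 < \<beta>" and l: "l \<in> Rd P" and x: "near_min y l \<beta> \<delta> x" and "0 < \<delta>"
  shows "norm ((x, Lx l \<beta> x) - (xo, lo)) \<le> norm ((y, l) - (xo, lo)) + 2 * sqrt (2 * \<delta> / \<beta>)"
proof -
  have xd: "x \<in> domg P" using x by (simp add: near_min_def)
  define D where "D = norm ((y, l) - (xo, lo))"
  define D' where "D' = norm ((x, Lx l \<beta> x) - (xo, lo))"
  define q where "q = 2 * \<delta> / \<beta>"
  have D2: "D\<^sup>2 = (norm (y - xo))\<^sup>2 + (norm (l - lo))\<^sup>2"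
    and D'2: "D'\<^sup>2 = (norm (x - xo))\<^sup>2 + (norm (Lx l \<beta> x - lo))\<^sup>2"
    by (simp_all add: D_def D'_def norm_Pair)
  have key: "(1 - t) * D'\<^sup>2 \<le> D\<^sup>2 + q / t" if t: "0 < t" "t < 1" for t
  proof -
    let ?w = "(1 - t) *\<^sub>R x + t *\<^sub>R xo"
    obtain v where v: "v \<in> domhconj P" and le: "H y l \<beta> ?w
      \<le> (1 - t) * (H y l \<beta> x - \<beta> / 2 * (norm (v - Lx l \<beta> x))\<^sup>2)
        + t * S y l \<beta> xo v - t * (1 - t) * (\<beta> / 2 * (norm (x - xo))\<^sup>2)"
      using H_segment[OF \<beta> l xd optimal_in_dom(1), of t] t by auto
    have 0: "0 \<le> (1 - t) * (\<beta> / 2 * (norm (v - Lx l \<beta> x))\<^sup>2)" using t \<beta> by simp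
    have "H y l \<beta> x \<le> H y l \<beta> ?w + \<delta>"
      using x t G_segment(1)[OF xd optimal_in_dom(1), of t] by (simp add: near_min_def)
    then have 1: "t * H y l \<beta> x \<le> t * S y l \<beta> xo v - t * (1 - t) * (\<beta> / 2 * (norm (x - xo))\<^sup>2) + \<delta>"
    proof -
      have "(1 - t) * (H y l \<beta> x - \<beta> / 2 * (norm (v - Lx l \<beta> x))\<^sup>2)
          = H y l \<beta> x - t * H y l \<beta> x - (1 - t) * (\<beta> / 2 * (norm (v - Lx l \<beta> x))\<^sup>2)"
        by (simp add: algebra_simps)
      then show ?thesis using \<open>H y l \<beta> x \<le> H y l \<beta> ?w + \<delta>\<close> le 0 by linarith
    qed
    have "0 \<le> \<beta> / 2 * (norm (v - l))\<^sup>2" using \<beta> by simp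
    then have "S y l \<beta> xo v \<le> Fs + \<beta> / 2 * (norm (xo - y))\<^sup>2"
      using saddle_dual[OF v] by (simp add: S_def)
    then have 2: "t * S y l \<beta> xo v \<le> t * (Fs + \<beta> / 2 * (norm (xo - y))\<^sup>2)"
      using t by (intro mult_left_mono) auto
    have "0 \<le> \<beta> / 2 * (norm (x - y))\<^sup>2" using \<beta> by simp
    then have "Fs - \<beta> / 2 * (norm (lo - l))\<^sup>2 + \<beta> / 2 * (norm (lo - Lx l \<beta> x))\<^sup>2 \<le> H y l \<beta> x"
      using S_le_H[OF \<beta> l optimal_in_dom(3), of y x] saddle_primal[OF xd] by (simp add: S_def)
    then have 3: "t * (Fs - \<beta> / 2 * (norm (lo - l))\<^sup>2 + \<beta> / 2 * (norm (lo - Lx l \<beta> x))\<^sup>2) \<le> t * H y l \<beta> x"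
      using t by (intro mult_left_mono) auto
    have "0 \<le> t * (t * (\<beta> / 2 * (norm (lo - Lx l \<beta> x))\<^sup>2))" using t \<beta> by simp
    moreover have "t * (\<beta> / 2 * ((1 - t) * D'\<^sup>2 - D\<^sup>2)) =
        t * (1 - t) * (\<beta> / 2 * (norm (x - xo))\<^sup>2)
        + t * (\<beta> / 2 * (norm (lo - Lx l \<beta> x))\<^sup>2) - t * (t * (\<beta> / 2 * (norm (lo - Lx l \<beta> x))\<^sup>2))
        - t * (\<beta> / 2 * (norm (xo - y))\<^sup>2) - t * (\<beta> / 2 * (norm (lo - l))\<^sup>2)"
      unfolding D2 D'2 norm_minus_commute[of xo] norm_minus_commute[of lo] by (simp add: field_simps)
    ultimately have "t * (\<beta> / 2 * ((1 - t) * D'\<^sup>2 - D\<^sup>2)) \<le> \<delta>"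
      using 1 2 3 unfolding distrib_left right_diff_distrib by linarith
    then show ?thesis using t \<beta> by (simp add: q_def field_simps)
  qed
  have q: "0 < q" using \<beta> \<open>0 < \<delta>\<close> by (simp add: q_def)
  define s where "s = sqrt q"
  have s: "0 < s" "s\<^sup>2 = q" using q by (simp_all add: s_def)
  have D0: "0 \<le> D" by (simp add: D_def)
  have "D' \<le> D + 2 * s"
  proof (rule ccontr)
    assume "\<not> D' \<le> D + 2 * s"
    then have a: "D + 2 * s < D'" by simp
    \<comment> \<open>\<open>t = s / D'\<close> balances \<open>t D'\<^sup>2\<close> against \<open>q / t\<close>.\<close>
    then have "0 < s / D'" "s / D' < 1" using s D0 by (auto simp: divide_simps)
    from key[OF this] have "(1 - s / D') * D'\<^sup>2 \<le> D\<^sup>2 + q / (s / D')" .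
    moreover have "(1 - s / D') * D'\<^sup>2 = D'\<^sup>2 - s * D'"
      using a s D0 by (simp add: field_simps power2_eq_square)
    moreover have "q / (s / D') = s * D'" using s by (simp add: power2_eq_square flip: s(2))
    ultimately have "D'\<^sup>2 - s * D' \<le> D\<^sup>2 + s * D'" by simp
    then have "(D' - s)\<^sup>2 \<le> D\<^sup>2 + s\<^sup>2" by (simp add: power2_eq_square algebra_simps)
    also have "\<dots> \<le> (D + s)\<^sup>2" using D0 s by (simp add: power2_eq_square algebra_simps)
    finally have "D' - s \<le> D + s" using D0 s by (intro power2_le_imp_le[of "D' - s"]) auto
    with a show False by simp
  qed
  then show ?thesis by (simp add: D_def D'_def s_def q_def)
qed

text \<open>
  \<open>w = A x - \<beta> (v - l)\<close> is a point of the domain of \<open>h\<close> at distance \<open>\<beta> \<parallel>v - l\<parallel>\<close> from \<open>A x\<close>, which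
  gives the infeasibility. The objective cannot be far below the optimum because \<open>lo\<close> prices
  this infeasibility, nor far above because the value at \<open>x\<close> is compared with the one at \<open>xo\<close>.
\<close>

lemma accuracy_of_near_min:
  assumes \<beta>: "0 < \<beta>" and l: "l \<in> Rd P" and x: "near_min y l \<beta> \<delta> x"
  defines "v \<equiv> Lx l \<beta> x"
  shows "infdist (A2 P x) (pK P) \<le> \<beta> * norm (v - l)"
    and "Fs - norm lo * (\<beta> * norm (v - l)) \<le> G x + ph1 P (A1 P x)"
    and "G x + ph1 P (A1 P x)
      \<le> Fs + \<delta> + \<beta> / 2 * (norm (xo - y))\<^sup>2 + \<beta> * norm (v - l) * (Lh + norm v + norm (v - l) / 2)"
proof -
  have xd: "x \<in> domg P" using x by (simp add: near_min_def)
  define w where "w = Amat P x - \<beta> *\<^sub>R (v - l)"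
  have w: "w \<in> domh" "hc v = v \<bullet> w - hval w"
    using prox_in_domh[OF \<beta> Amat_in_Rd l] hc_Lam[OF \<beta> Amat_in_Rd l] by (simp_all add: w_def v_def)
  have d: "norm (Amat P x - w) = \<beta> * norm (v - l)" using \<beta> by (simp add: w_def)
  have "infdist (A2 P x) (pK P) \<le> dist (A2 P x) (snd w)"
    using w(1) by (intro infdist_le) auto
  also have "\<dots> = norm (snd (Amat P x - w))" by (simp add: dist_norm Amat_def)
  also have "\<dots> \<le> norm (Amat P x - w)" by (metis norm_snd_le prod.collapse)
  finally show "infdist (A2 P x) (pK P) \<le> \<beta> * norm (v - l)" by (simp add: d)
  have w': "(A1 P x, snd w) \<in> domh"
    using w(1) Amat_in_Rd[of P x] by (auto simp: Amat_def)
  have "Fs \<le> G x + lo \<bullet> Amat P x - hc lo" by (rule saddle_primal[OF xd])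
  also have "\<dots> \<le> G x + lo \<bullet> (Amat P x - (A1 P x, snd w)) + ph1 P (A1 P x)"
    using fenchel_young[OF optimal_in_dom(3) w'] by (simp add: inner_diff_right)
  also have "lo \<bullet> (Amat P x - (A1 P x, snd w)) \<le> norm lo * norm (Amat P x - (A1 P x, snd w))"
    by (rule norm_cauchy_schwarz)
  also have "norm (Amat P x - (A1 P x, snd w)) = norm (snd (Amat P x - w))"
    by (simp add: Amat_def norm_Pair)
  also have "\<dots> \<le> norm (Amat P x - w)" by (metis norm_snd_le prod.collapse)
  finally show "Fs - norm lo * (\<beta> * norm (v - l)) \<le> G x + ph1 P (A1 P x)"
    by (simp add: d mult_left_mono)
  have "ph1 P (A1 P x) \<le> hval w + Lh * norm (fst (Amat P x - w))"
    using h1_lipschitz[of "A1 P x" "fst w"] w' w(1) by (auto simp: Amat_def)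
  also have "norm (fst (Amat P x - w)) \<le> norm (Amat P x - w)" by (metis norm_fst_le prod.collapse)
  finally have 1: "ph1 P (A1 P x) \<le> hval w + Lh * (\<beta> * norm (v - l))"
    using Lh_nonneg by (simp add: d mult_left_mono)
  have "- (v \<bullet> (Amat P x - w)) \<le> norm v * norm (Amat P x - w)"
    using Cauchy_Schwarz_ineq2[of v "Amat P x - w"] by linarith
  then have 2: "hval w - norm v * (\<beta> * norm (v - l)) \<le> v \<bullet> Amat P x - hc v"
    using w(2) by (simp add: d inner_diff_right)
  have "H y l \<beta> x \<le> H y l \<beta> xo + \<delta>" using x optimal_in_dom(1) by (simp add: near_min_def)
  moreover have "H y l \<beta> xo \<le> Fs + \<beta> / 2 * (norm (xo - y))\<^sup>2"
  proof -
    have "0 \<le> \<beta> / 2 * (norm (Lx l \<beta> xo - l))\<^sup>2" using \<beta> by simp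
    then show ?thesis
      using saddle_dual[OF Lam_in_dom[OF \<beta> Amat_in_Rd l], of xo] by (simp add: H_def S_def)
  qed
  moreover have "0 \<le> \<beta> / 2 * (norm (x - y))\<^sup>2" using \<beta> by simp
  ultimately have "G x + (v \<bullet> Amat P x - hc v) \<le> Fs + \<delta> + \<beta> / 2 * (norm (xo - y))\<^sup>2 + \<beta> / 2 * (norm (v - l))\<^sup>2"
    by (simp add: H_def S_def v_def)
  with 1 2 have "G x + ph1 P (A1 P x) \<le> Fs + \<delta> + \<beta> / 2 * (norm (xo - y))\<^sup>2 + \<beta> / 2 * (norm (v - l))\<^sup>2
     + norm v * (\<beta> * norm (v - l)) + Lh * (\<beta> * norm (v - l))" by linarith
  then show "G x + ph1 P (A1 P x)
      \<le> Fs + \<delta> + \<beta> / 2 * (norm (xo - y))\<^sup>2 + \<beta> * norm (v - l) * (Lh + norm v + norm (v - l) / 2)"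
    by (simp add: algebra_simps power2_eq_square)
qed

end

section \<open>Single steps of the algorithm\<close>

context composite_problem
begin

text \<open>
  Up to an additive constant, the model minimized in a step is one of the problems that relative
  smoothness declares solvable: all gradients enter linearly and can be absorbed, together with the
  quadratic part of the reference function, into the centre \<open>x'\<close> of the quadratic term by completing
  the square. The minimizer therefore exists, and its model value is finite like that at \<open>x\<close>.
\<close>

lemma bpg_step_in_domg:
  assumes rel: "relatively_smooth P \<xi> \<mu> Lf" and y: "y \<in> Rx P" and "0 < \<beta>" and x: "x \<in> domg P"
  shows "bpg_step P \<xi> Lf y l \<beta> x \<in> domg P"
proof -
  define n where "n = dimx P"
  define \<alpha> where "\<alpha> = max ((normA P)\<^sup>2 / \<beta>) Lf"
  have \<alpha>: "0 < \<alpha>" using rel by (auto simp: \<alpha>_def relatively_smooth_def Let_def)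
  define c where "c = grad n (\<lambda>w. pf P w + hsmooth P (Amat P w) l \<beta>) x"
  define d where "d = grad n (\<lambda>w. \<xi> w + ereal ((norm w)\<^sup>2 / 2)) x"
  define e where "e = grad n \<xi> x"
  define q where "q = trunc n (\<alpha> *\<^sub>R d - \<alpha> *\<^sub>R e - c)"
  define \<beta>' where "\<beta>' = \<beta> + \<alpha>"
  have \<beta>': "0 < \<beta>'" using \<alpha> \<open>0 < \<beta>\<close> by (simp add: \<beta>'_def)
  define p where "p = q + \<beta> *\<^sub>R y"
  define k where "k = q \<bullet> x + \<beta> / 2 * (norm y)\<^sup>2 - \<alpha> / 2 * (norm x)\<^sup>2 - (norm p)\<^sup>2 / (2 * \<beta>')"
  define obj where "obj z = ereal (c \<bullet> (z - x)) + (pg P z + ereal (\<beta> / 2 * (norm (z - y))\<^sup>2))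
    + ereal \<alpha> * bregman n (\<lambda>w. \<xi> w + ereal ((norm w)\<^sup>2 / 2)) z x" for z
  define robj where "robj z = pg P z + ereal (\<beta>' / 2 * (norm (z - p /\<^sub>R \<beta>'))\<^sup>2)
    + ereal \<alpha> * bregman n \<xi> z x" for z
  have step: "bpg_step P \<xi> Lf y l \<beta> x = arg_min obj (\<lambda>z. z \<in> Rn n)"
    by (simp add: bpg_step_def Let_def n_def \<alpha>_def c_def obj_def[abs_def])
  have xR: "x \<in> Rn n" using x by (simp add: edom_def n_def)
  obtain v where grad: "has_gradient n \<xi> x v"
    using rel x unfolding relatively_smooth_def differentiable_around_def Let_def n_def by blast
  then obtain \<xi>x where \<xi>x: "\<xi> x = ereal \<xi>x" by (cases "\<xi> x") (auto simp: has_gradient_def)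
  have \<xi>: "\<xi> z \<noteq> -\<infinity>" if "z \<in> Rn n" for z
    using rel that by (auto simp: relatively_smooth_def Let_def convex_fun_def n_def)
  have g: "pg P z \<noteq> -\<infinity>" if "z \<in> Rn n" for z
    using pg_not_MInf that by (simp add: n_def)
  have eq: "obj z = robj z + ereal k" if z: "z \<in> Rn n" for z
  proof -
    have "q \<bullet> (z - x) = \<alpha> * (d \<bullet> (z - x)) - \<alpha> * (e \<bullet> (z - x)) - c \<bullet> (z - x)"
      unfolding q_def trunc_inner[OF Rn_diff[OF z xR]] by (simp add: inner_diff_left)
    moreover have "\<beta>' / 2 * (norm (z - p /\<^sub>R \<beta>'))\<^sup>2
        = \<beta> / 2 * (norm z)\<^sup>2 + \<alpha> / 2 * (norm z)\<^sup>2 - p \<bullet> z + (norm p)\<^sup>2 / (2 * \<beta>')"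
    proof -
      have "\<beta>' / 2 * (norm (z - p /\<^sub>R \<beta>'))\<^sup>2 = \<beta>' / 2 * (norm z)\<^sup>2 - p \<bullet> z + (norm p)\<^sup>2 / (2 * \<beta>')"
        using \<beta>' by (simp add: power2_norm_eq_inner inner_simps inner_commute field_simps)
      then show ?thesis by (simp add: \<beta>'_def field_simps)
    qed
    moreover have "\<beta> / 2 * (norm (z - y))\<^sup>2 = \<beta> / 2 * (norm z)\<^sup>2 - \<beta> * (y \<bullet> z) + \<beta> / 2 * (norm y)\<^sup>2"
      by (simp add: power2_norm_eq_inner inner_simps inner_commute field_simps)
    moreover have "p \<bullet> z = q \<bullet> z + \<beta> * (y \<bullet> z)" by (simp add: p_def inner_add_left)
    moreover have "q \<bullet> (z - x) = q \<bullet> z - q \<bullet> x" by (rule inner_diff_right)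
    ultimately have real: "c \<bullet> (z - x) + \<beta> / 2 * (norm (z - y))\<^sup>2
        + (\<alpha> / 2 * (norm z)\<^sup>2 - \<alpha> / 2 * (norm x)\<^sup>2 - \<alpha> * (d \<bullet> (z - x)))
      = \<beta>' / 2 * (norm (z - p /\<^sub>R \<beta>'))\<^sup>2 - \<alpha> * (e \<bullet> (z - x)) + k"
      unfolding k_def by linarith
    show ?thesis
    proof (cases "pg P z = \<infinity> \<or> \<xi> z = \<infinity>")
      case True
      then show ?thesis
        using \<alpha> by (auto simp: obj_def robj_def bregman_def \<xi>x)
    next
      case False
      then obtain gz \<xi>z where "pg P z = ereal gz" "\<xi> z = ereal \<xi>z"
        using g[OF z] \<xi>[OF z] by (cases "pg P z"; cases "\<xi> z") auto
      then show ?thesis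
        using real by (simp add: obj_def robj_def bregman_def \<xi>x d_def[symmetric] e_def[symmetric] right_diff_distrib distrib_left)
    qed
  qed
  have "x \<in> edom n \<xi>" using xR \<xi>x by (simp add: edom_def)
  moreover have "p /\<^sub>R \<beta>' \<in> Rn n"
    using y by (auto simp: p_def q_def n_def intro!: Rn_scale Rn_add trunc_in_Rn)
  ultimately obtain z where "is_arg_min robj (\<lambda>y. y \<in> Rn n) z"
    using rel \<alpha> \<beta>' grad unfolding relatively_smooth_def Let_def robj_def[abs_def] n_def by blast
  then have "is_arg_min obj (\<lambda>y. y \<in> Rn n) z"
    unfolding is_arg_min_def using eq by (auto simp: not_less intro: add_right_mono)
  then have "is_arg_min obj (\<lambda>y. y \<in> Rn n) (bpg_step P \<xi> Lf y l \<beta> x)"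
    unfolding step arg_min_def by (rule someI)
  then have wR: "bpg_step P \<xi> Lf y l \<beta> x \<in> Rn n" and le: "obj (bpg_step P \<xi> Lf y l \<beta> x) \<le> obj x"
    using xR by (auto simp: is_arg_min_def not_less)
  have "obj x < \<infinity>"
    using pf_pg_finite(2)[OF x] by (cases "pg P x") (auto simp: obj_def bregman_def \<xi>x)
  then have "pg P (bpg_step P \<xi> Lf y l \<beta> x) < \<infinity>"
    using le by (cases "pg P (bpg_step P \<xi> Lf y l \<beta> x)") (auto simp: obj_def)
  with wR show ?thesis by (simp add: edom_def n_def)
qed

lemma bpg_in_domg:
  assumes "relatively_smooth P \<xi> \<mu> Lf" "y \<in> Rx P" "0 < \<beta>" "x \<in> domg P"
  shows "bpg P \<xi> Lf x k y l \<beta> \<in> domg P"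
  unfolding bpg_def by (induction k) (auto intro: bpg_step_in_domg[OF assms(1-3)] assms(4))

text \<open>
  With \<open>v = Lam P u l' \<beta>'\<close>, the vectors \<open>u - \<beta> (l' - l)\<close> and \<open>u - \<beta>' (v - l')\<close> are subgradients of the
  conjugate at \<open>l'\<close> and at \<open>v\<close>; the claim follows from the monotonicity of the subdifferential.
\<close>

lemma Lam_restart_le:
  assumes "0 < \<beta>" "0 < \<beta>'" "l \<in> Rd P" "u \<in> Rd P"
  defines "l' \<equiv> Lam P u l \<beta>"
  shows "\<beta>' * norm (Lam P u l' \<beta>' - l') \<le> \<beta> * norm (l' - l)"
proof -
  have l': "l' \<in> domhconj P" unfolding l'_def by (rule Lam_in_dom[OF assms(1,4,3)])
  then have l'R: "l' \<in> Rd P" by (simp add: domhconj_def)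
  define v where "v = Lam P u l' \<beta>'"
  have v: "v \<in> domhconj P" unfolding v_def by (rule Lam_in_dom[OF assms(2,4) l'R])
  have "v \<bullet> u - hc v \<le> l' \<bullet> u - hc l' + \<beta> * ((l' - l) \<bullet> (v - l'))"
    using Lam_subgradient[OF assms(1,4,3) v] by (simp add: l'_def)
  moreover have "l' \<bullet> u - hc l' \<le> v \<bullet> u - hc v + \<beta>' * ((v - l') \<bullet> (l' - v))"
    using Lam_subgradient[OF assms(2,4) l'R l'] by (simp add: v_def)
  moreover have "(v - l') \<bullet> (l' - v) = - (norm (v - l'))\<^sup>2"
    by (simp add: power2_norm_eq_inner inner_simps inner_commute)
  ultimately have "\<beta>' * (norm (v - l'))\<^sup>2 \<le> \<beta> * ((l' - l) \<bullet> (v - l'))" by simp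
  also have "\<dots> \<le> \<beta> * (norm (l' - l) * norm (v - l'))"
    using assms(1) by (intro mult_left_mono norm_cauchy_schwarz) auto
  finally show ?thesis
    unfolding v_def[symmetric] using assms(1) by (cases "v = l'") (auto simp: power2_eq_square)
qed

end

text \<open>
  All expectations in the theorem are therefore expectations of constants.
\<close>

lemma ipalm_run_deterministic:
  assumes "ipalm_run P \<xi> Lf Lh \<beta> \<epsilon> m0 K x' lam0 x lam m"
    and "ipalm_run P \<xi> Lf Lh \<beta> \<epsilon> m0 K x' lam0 y mu k"
  shows "x s = y s \<and> m s = k s"
proof -
  have "\<forall>t\<le>s. x t = y t \<and> lam t = mu t \<and> m t = k t"
  proof (induction s)
    case 0
    then show ?case using assms by (simp add: ipalm_run_def)
  next
    case (Suc s)
    have lam: "lam (Suc s) = mu (Suc s)" using assms Suc by (simp add: ipalm_run_def)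
    have pr: "prev x' x s = prev x' y s" using Suc by (cases s) (auto simp: prev_def)
    have "Mterm P Lh \<beta> x' x lam s = Mterm P Lh \<beta> x' y mu s"
      using Suc lam pr by (simp add: Mterm_def)
    then have m: "m (Suc s) = k (Suc s)" using assms by (simp add: ipalm_run_def)
    then have "x (Suc s) = y (Suc s)" using assms Suc lam by (simp add: ipalm_run_def)
    with Suc lam m show ?case by (auto simp: le_Suc_eq)
  qed
  then show ?thesis by blast
qed

lemma least_inner_iterations:
  fixes B K e :: real
  assumes "1 \<le> K" "0 < e" "1 \<le> q" "B \<le> 2 ^ q * e / 2"
  defines "m \<equiv> LEAST k. 0 < k \<and> B \<le> 2 powi \<lfloor>real k / K\<rfloor> * e / 2"
  shows "2 powi (- \<lfloor>real m / K\<rfloor>) * B \<le> e" and "real m \<le> real q * K + 1"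
proof -
  define k where "k = nat \<lceil>real q * K\<rceil>"
  have qK: "1 \<le> real q * K" using mult_mono[of 1 "real q" 1 K] assms(1,3) by simp
  have k: "real q * K \<le> real k" "real k \<le> real q * K + 1"
    unfolding k_def using qK by linarith+
  have "real q \<le> real k / K" using k(1) assms(1) by (simp add: pos_le_divide_eq)
  then have "int q \<le> \<lfloor>real k / K\<rfloor>" by (simp add: le_floor_iff)
  then have "(2::real) powi int q \<le> 2 powi \<lfloor>real k / K\<rfloor>" by (intro power_int_increasing) auto
  then have "2 ^ q * e / 2 \<le> 2 powi \<lfloor>real k / K\<rfloor> * e / 2" using assms(2) by simp
  then have P: "0 < k \<and> B \<le> 2 powi \<lfloor>real k / K\<rfloor> * e / 2"
    using assms(4) k(1) qK by auto
  have "m \<le> k" unfolding m_def by (rule Least_le) (rule P)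
  then show "real m \<le> real q * K + 1" using k(2) by linarith
  have "0 < m \<and> B \<le> 2 powi \<lfloor>real m / K\<rfloor> * e / 2"
    unfolding m_def by (rule LeastI[where k = k]) (rule P)
  then have m: "B \<le> 2 powi \<lfloor>real m / K\<rfloor> * e / 2" by simp
  let ?p = "(2::real) powi \<lfloor>real m / K\<rfloor>"
  have p: "0 < ?p" by simp
  have "inverse ?p * B \<le> inverse ?p * (?p * e / 2)" using p m by (intro mult_left_mono) auto
  also have "\<dots> = e / 2" using p by simp
  finally show "2 powi (- \<lfloor>real m / K\<rfloor>) * B \<le> e" using assms(2) by (simp add: power_int_minus)
qed

section \<open>The outer loop\<close>

text \<open>
  \<open>R\<close> stands for any radius that dominates the initial distance to the saddle point plus the summed
  errors of \<open>quasi_fejer\<close>, as well as the norms of the saddle point and the Lipschitz constant. The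
  problem enters the bounds on \<open>Mterm\<close> and on the accuracy through \<open>R\<close> alone.
\<close>

locale ipalm = saddle_problem +
  fixes \<rho> \<eta> \<beta>0 \<epsilon>0 R :: real and \<xi> :: "fvec \<Rightarrow> ereal" and \<mu> Lf :: real and m0 :: nat and K :: "nat \<Rightarrow> real"
    and x' :: fvec and lam0 :: "fvec \<times> fvec"
    and x :: "nat \<Rightarrow> fvec" and lam :: "nat \<Rightarrow> fvec \<times> fvec" and m :: "nat \<Rightarrow> nat"
    and \<beta> \<epsilon>s :: "nat \<Rightarrow> real"
  defines "\<beta> \<equiv> \<lambda>s. \<beta>0 * \<rho> ^ s" and "\<epsilon>s \<equiv> \<lambda>s. \<epsilon>0 * \<eta> ^ s"
  assumes \<rho>: "1 / 2 < \<rho>" "\<rho> < 1" and \<eta>: "0 < \<eta>" "\<eta> < \<rho>" and \<beta>0: "0 < \<beta>0" and \<epsilon>0: "0 < \<epsilon>0"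
    and rel: "relatively_smooth P \<xi> \<mu> Lf"
    and x'_dom: "x' \<in> domg P" and lam0_dom: "lam0 \<in> domhconj P"
    and K_ge: "\<And>s. 1 \<le> K s"
    and run: "ipalm_run P \<xi> Lf Lh \<beta> \<epsilon>s m0 K x' lam0 x lam m"
    and inner: "inner_guarantee P \<xi> Lf \<beta> K x' x lam"
    and R_start: "norm ((x', lam0) - (xo, lo)) + 4 * sqrt (\<epsilon>0 / \<beta>0) / (1 - sqrt (\<eta> / \<rho>)) \<le> R"
    and R_xo: "norm xo \<le> R" and R_lo: "norm lo \<le> R" and R_Lh: "Lh \<le> R"
begin

lemma \<beta>_pos: "0 < \<beta> s" and \<epsilon>_pos: "0 < \<epsilon>s s"
  using \<beta>0 \<epsilon>0 \<rho> \<eta> by (simp_all add: \<beta>_def \<epsilon>s_def)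

lemma \<beta>_Suc: "\<beta> (Suc s) = \<rho> * \<beta> s"
  by (simp add: \<beta>_def)

abbreviation M :: "nat \<Rightarrow> real"
  where "M s \<equiv> Mterm P Lh \<beta> x' x lam s"

lemma run_start: "m 0 = m0" "lam 0 = lam0" "x 0 = bpg P \<xi> Lf x' m0 x' lam0 (\<beta> 0)"
    "Hobj P x' lam0 (\<beta> 0) (x 0) - Hmin P x' lam0 (\<beta> 0) \<le> ereal (\<epsilon>s 0)"
  and lam_Suc: "lam (Suc s) = Lx (lam s) (\<beta> s) (x s)"
  and m_Suc: "m (Suc s) = (LEAST k. 0 < k \<and>
    2 * \<epsilon>s s + M s \<le> 2 powi \<lfloor>real k / K (Suc s)\<rfloor> * \<epsilon>s (Suc s) / 2)"
  and x_Suc: "x (Suc s) = bpg P \<xi> Lf (x s) (m (Suc s)) (x s) (lam (Suc s)) (\<beta> (Suc s))"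
  using run unfolding ipalm_run_def by blast+

lemma lam_dom: "lam s \<in> domhconj P"
proof (induction s)
  case (Suc s)
  then have "lam s \<in> Rd P" by (simp add: domhconj_def)
  then show ?case unfolding lam_Suc by (rule Lam_in_dom[OF \<beta>_pos Amat_in_Rd])
qed (simp add: run_start lam0_dom)

lemma lam_Rd: "lam s \<in> Rd P"
  using lam_dom[of s] by (simp add: domhconj_def)

lemma domg_Rx: "z \<in> domg P \<Longrightarrow> z \<in> Rx P"
  by (simp add: edom_def)

lemma x_dom: "x s \<in> domg P"
proof (induction s)
  case 0
  show ?case unfolding run_start(3) by (rule bpg_in_domg[OF rel domg_Rx[OF x'_dom] \<beta>_pos x'_dom])
next
  case (Suc s)
  show ?case unfolding x_Suc by (rule bpg_in_domg[OF rel domg_Rx[OF Suc] \<beta>_pos Suc])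
qed

lemma prev_Suc: "prev x' x (Suc s) = x s"
  by (simp add: prev_def)

text \<open>
  The rule that selects the number of inner iterations is tailored to \<open>warm_start_gap\<close>: the inner
  solver has to shrink a gap of at most \<open>2 * \<epsilon>s s + M s\<close> to \<open>\<epsilon>s (Suc s)\<close>.
\<close>

lemma near_min_run: "near_min (prev x' x s) (lam s) (\<beta> s) (\<epsilon>s s) (x s)"
proof (induction s)
  case 0
  show ?case
    using run_start(4) unfolding run_start(2)[symmetric] gap_le_iff_near_min[OF \<beta>_pos lam_Rd x_dom]
    by (simp add: prev_def)
next
  case (Suc s)
  let ?l = "lam (Suc s)" and ?b = "\<beta> (Suc s)" and ?B = "2 * \<epsilon>s s + M s"
  let ?p = "2 powi (- \<lfloor>real (m (Suc s)) / K (Suc s)\<rfloor>) :: real"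
  have "near_min (x s) ?l ?b ?B (x s)"
    using warm_start_gap[OF \<beta>_pos _ _ lam_Rd Suc, of ?b, folded lam_Suc] \<rho> \<beta>_pos[of s]
    by (simp add: Mterm_def \<beta>_Suc)
  then have warm: "Hobj P (x s) ?l ?b (x s) - Hmin P (x s) ?l ?b \<le> ereal ?B"
    by (simp add: gap_le_iff_near_min[OF \<beta>_pos lam_Rd x_dom])
  have "Hobj P (x s) ?l ?b (x (Suc s)) - Hmin P (x s) ?l ?b
      \<le> ereal ?p * (Hobj P (x s) ?l ?b (x s) - Hmin P (x s) ?l ?b)"
    using inner x_dom[of s] unfolding inner_guarantee_def Let_def x_Suc[of s] by (metis prev_Suc)
  also have "\<dots> \<le> ereal ?p * ereal ?B"
    by (intro ereal_mult_left_mono warm) simp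
  also have "\<dots> \<le> ereal (\<epsilon>s (Suc s))"
  proof -
    obtain q where "?B * 2 / \<epsilon>s (Suc s) < 2 ^ q" using real_arch_pow[of 2] by auto
    also have "(2::real) ^ q \<le> 2 ^ Suc q" by simp
    finally have "?B \<le> 2 ^ Suc q * \<epsilon>s (Suc s) / 2"
      using \<epsilon>_pos[of "Suc s"] by (simp add: field_simps)
    from least_inner_iterations(1)[OF K_ge[of "Suc s"] \<epsilon>_pos _ this]
    show ?thesis by (simp add: m_Suc)
  qed
  finally show ?case
    by (simp add: gap_le_iff_near_min[OF \<beta>_pos lam_Rd x_dom] prev_Suc)
qed

text \<open>
  The errors \<open>sqrt (\<epsilon>s s / \<beta> s)\<close> of \<open>quasi_fejer\<close> form a geometric series of ratio \<open>sqrt (\<eta> / \<rho>) < 1\<close>.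
\<close>

lemma distance_to_saddle: "norm ((prev x' x s, lam s) - (xo, lo)) \<le> R"
proof -
  define c where "c = sqrt (\<epsilon>0 / \<beta>0)"
  define r where "r = sqrt (\<eta> / \<rho>)"
  have r: "0 < r" "r < 1" using \<rho> \<eta> by (simp_all add: r_def)
  have c: "0 \<le> c" using \<beta>0 \<epsilon>0 by (simp add: c_def)
  let ?D = "\<lambda>s. norm ((prev x' x s, lam s) - (xo, lo))"
  have "?D s \<le> ?D 0 + 4 * c * ((1 - r ^ s) / (1 - r))"
  proof (induction s)
    case (Suc s)
    have "\<epsilon>s s / \<beta> s = \<epsilon>0 / \<beta>0 * (\<eta> / \<rho>) ^ s" by (simp add: \<epsilon>s_def \<beta>_def power_divide)
    then have e: "sqrt (\<epsilon>s s / \<beta> s) = c * r ^ s" by (simp only: c_def r_def real_sqrt_mult real_sqrt_power)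
    have "sqrt (2 * \<epsilon>s s / \<beta> s) = sqrt 2 * sqrt (\<epsilon>s s / \<beta> s)"
      by (simp flip: real_sqrt_mult)
    also have "\<dots> \<le> 2 * sqrt (\<epsilon>s s / \<beta> s)"
      using \<epsilon>_pos[of s] \<beta>_pos[of s] sqrt2_less_2 by (intro mult_right_mono) auto
    finally have "2 * sqrt (2 * \<epsilon>s s / \<beta> s) \<le> 4 * c * r ^ s" by (simp add: e)
    then have "?D (Suc s) \<le> ?D s + 4 * c * r ^ s"
      using quasi_fejer[OF \<beta>_pos lam_Rd near_min_run \<epsilon>_pos, of s] by (simp add: prev_Suc lam_Suc)
    moreover have "(1 - r ^ s) / (1 - r) + r ^ s = (1 - r ^ Suc s) / (1 - r)"
      using r by (simp add: field_simps)
    then have "4 * c * ((1 - r ^ s) / (1 - r)) + 4 * c * r ^ s = 4 * c * ((1 - r ^ Suc s) / (1 - r))"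
      by (metis distrib_left)
    ultimately show ?case using Suc by linarith
  qed simp
  also have "4 * c * ((1 - r ^ s) / (1 - r)) \<le> 4 * c * (1 / (1 - r))"
    using r c by (intro mult_left_mono divide_right_mono) auto
  also have "?D 0 + 4 * c * (1 / (1 - r)) \<le> R"
    using R_start by (simp add: c_def r_def prev_def run_start(2))
  finally show ?thesis by simp
qed

lemma iterate_bounds:
  "norm (prev x' x s - xo) \<le> R" "norm (lam s) \<le> 2 * R"
  "norm (lam (Suc s) - lam s) \<le> 2 * R" "norm (prev x' x s - x s) \<le> 2 * R"
proof -
  have p: "norm (prev x' x s - xo) \<le> R" for s
    using norm_fst_le[of "prev x' x s - xo" "lam s - lo"] distance_to_saddle[of s] by simp
  have l: "norm (lam s - lo) \<le> R" for s
    using norm_snd_le[of "lam s - lo" "prev x' x s - xo"] distance_to_saddle[of s] by simp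
  show "norm (prev x' x s - xo) \<le> R" by (rule p)
  show "norm (lam s) \<le> 2 * R"
    using norm_triangle_ineq[of "lam s - lo" lo] l[of s] R_lo by simp
  show "norm (lam (Suc s) - lam s) \<le> 2 * R"
    using norm_triangle_ineq4[of "lam (Suc s) - lo" "lam s - lo"] l[of s] l[of "Suc s"] by simp
  show "norm (prev x' x s - x s) \<le> 2 * R"
    using norm_triangle_ineq4[of "prev x' x s - xo" "x s - xo"] p[of s] p[of "Suc s"] by (simp add: prev_Suc)
qed

lemma R_nonneg: "0 \<le> R"
  using R_xo norm_ge_zero[of xo] by linarith

lemma Mterm_bound: "M s \<le> \<beta> s * (R\<^sup>2 * (24 + 2 / \<rho>\<^sup>2 + 4 / (2 * \<rho> - 1)))"
proof -
  let ?b = "\<beta> s" and ?b' = "\<beta> (Suc s)" and ?d = "norm (lam (Suc s) - lam s)"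
  have b: "0 < ?b" "?b' = \<rho> * ?b" "0 < ?b'" "?b' \<le> ?b"
    using \<beta>_pos \<rho> by (auto simp: \<beta>_Suc)
  note B = iterate_bounds[of s] iterate_bounds[of "Suc s"]
  have d2: "?d\<^sup>2 \<le> 4 * R\<^sup>2" using power_mono[OF B(3), of 2] by (simp add: power_mult_distrib)
  have 1: "?b * ?d\<^sup>2 \<le> ?b * (4 * R\<^sup>2)" using d2 b by simp
  let ?w = "norm (Lam P (Amat P (x s)) (lam (Suc s)) ?b' - lam (Suc s))"
  have "?b' * ?w \<le> ?b * ?d"
    using Lam_restart_le[OF b(1,3) lam_Rd[of s] Amat_in_Rd[of P "x s"]] by (simp add: lam_Suc)
  then have "?b * (\<rho> * ?w) \<le> ?b * ?d" by (simp add: b(2) mult.left_commute mult.commute)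
  then have "\<rho> * ?w \<le> ?d" using b by simp
  then have "?w \<le> 2 * R / \<rho>" using B(3) \<rho> by (simp add: field_simps)
  then have w2: "?w\<^sup>2 \<le> 4 * R\<^sup>2 / \<rho>\<^sup>2"
    using power_mono[of ?w "2 * R / \<rho>" 2] by (simp add: power_mult_distrib power_divide)
  have 2: "(?b - ?b') / 2 * ?w\<^sup>2 \<le> ?b * (2 * R\<^sup>2 / \<rho>\<^sup>2)"
    using mult_mono[of "(?b - ?b') / 2" "?b / 2" "?w\<^sup>2", OF _ w2] b by simp
  have "(norm (prev x' x s - x s))\<^sup>2 \<le> 4 * R\<^sup>2"
    using power_mono[OF B(4), of 2] by (simp add: power_mult_distrib)
  moreover have c: "?b\<^sup>2 / (2 * ?b' - ?b) = ?b / (2 * \<rho> - 1)"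
  proof -
    have "2 * ?b' - ?b = ?b * (2 * \<rho> - 1)" by (simp add: b(2) algebra_simps)
    then show ?thesis using b(1) by (simp add: power2_eq_square)
  qed
  ultimately have 3: "?b\<^sup>2 / (2 * ?b' - ?b) * (norm (prev x' x s - x s))\<^sup>2 \<le> ?b * (4 * R\<^sup>2 / (2 * \<rho> - 1))"
    using mult_left_mono[of "(norm (prev x' x s - x s))\<^sup>2" "4 * R\<^sup>2" "?b / (2 * \<rho> - 1)"] b(1) \<rho>
    by (simp add: c)
  have n: "norm (?b *\<^sub>R \<pi> (lam s) - ?b' *\<^sub>R \<pi> (lam (Suc s))) \<le> 4 * ?b * R"
    if "\<And>v. norm (\<pi> v) \<le> norm v" for \<pi> :: "fvec \<times> fvec \<Rightarrow> fvec"
  proof -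
    have "norm (?b *\<^sub>R \<pi> (lam s) - ?b' *\<^sub>R \<pi> (lam (Suc s))) \<le> ?b * norm (\<pi> (lam s)) + ?b' * norm (\<pi> (lam (Suc s)))"
      using norm_triangle_ineq4[of "?b *\<^sub>R \<pi> (lam s)" "?b' *\<^sub>R \<pi> (lam (Suc s))"] b by simp
    also have "\<dots> \<le> ?b * (2 * R) + ?b * (2 * R)"
      using b R_nonneg order_trans[OF that B(2)] order_trans[OF that B(6)] by (intro add_mono mult_mono) auto
    finally show ?thesis by (simp add: mult.commute mult.left_commute)
  qed
  have nf: "norm (fst v) \<le> norm v" "norm (snd v) \<le> norm v" for v :: "fvec \<times> fvec"
    by (metis norm_fst_le prod.collapse) (metis norm_snd_le prod.collapse)
  have "(?b + ?b') * Lh \<le> 2 * ?b * R"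
    using b R_Lh Lh_nonneg by (intro mult_mono) auto
  then have "sqrt (((?b + ?b') * Lh + norm (?b *\<^sub>R fst (lam s) - ?b' *\<^sub>R fst (lam (Suc s))))\<^sup>2
      + (norm (?b *\<^sub>R snd (lam s) - ?b' *\<^sub>R snd (lam (Suc s))))\<^sup>2)
      \<le> sqrt ((6 * ?b * R)\<^sup>2 + (4 * ?b * R)\<^sup>2)"
    using n[of fst, OF nf(1)] n[of snd, OF nf(2)] b(1,3) Lh_nonneg
    by (intro real_sqrt_le_mono add_mono power_mono add_nonneg_nonneg mult_nonneg_nonneg) simp_all
  also have "\<dots> \<le> 6 * ?b * R + 4 * ?b * R"
    using b R_nonneg by (intro sqrt_sum_squares_le_sum) auto
  finally have 4: "?d * sqrt (((?b + ?b') * Lh + norm (?b *\<^sub>R fst (lam s) - ?b' *\<^sub>R fst (lam (Suc s))))\<^sup>2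
      + (norm (?b *\<^sub>R snd (lam s) - ?b' *\<^sub>R snd (lam (Suc s))))\<^sup>2) \<le> 2 * R * (10 * ?b * R)"
    using B(3) R_nonneg by (intro mult_mono) (auto simp: mult.commute mult.left_commute)
  have "?b * (4 * R\<^sup>2) + ?b * (2 * R\<^sup>2 / \<rho>\<^sup>2) + ?b * (4 * R\<^sup>2 / (2 * \<rho> - 1)) + 2 * R * (10 * ?b * R)
      = ?b * (R\<^sup>2 * (24 + 2 / \<rho>\<^sup>2 + 4 / (2 * \<rho> - 1)))"
    by (simp add: algebra_simps power2_eq_square)
  with 1 2 3 4 show ?thesis unfolding Mterm_def by linarith
qed

text \<open>
  By \<open>Mterm_bound\<close> the required reduction factor is at most a constant times \<open>(\<rho> / \<eta>) ^ s\<close>, so its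
  logarithm grows only linearly in \<open>s\<close>; \<open>\<alpha>\<close> is a common bound for the logarithm of the constant and
  for the growth rate.
\<close>

lemma inner_iterations_bound:
  assumes "1 \<le> \<alpha>" "\<rho> / \<eta> \<le> 2 ^ \<alpha>"
    and "4 / \<eta> + 2 * (R\<^sup>2 * (24 + 2 / \<rho>\<^sup>2 + 4 / (2 * \<rho> - 1))) * \<beta>0 / (\<epsilon>0 * \<eta>) \<le> 2 ^ \<alpha>"
  shows "real (m (Suc s)) \<le> real (\<alpha> * Suc s) * K (Suc s) + 1"
proof -
  let ?W = "R\<^sup>2 * (24 + 2 / \<rho>\<^sup>2 + 4 / (2 * \<rho> - 1))"
  have e: "0 < \<epsilon>s s * \<eta> / 2" using \<epsilon>_pos[of s] \<eta> by simp
  have q1: "1 \<le> (\<rho> / \<eta>) ^ s" using \<eta> by (intro one_le_power) simp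
  have b: "\<beta> s = (\<rho> / \<eta>) ^ s * \<beta>0 * \<epsilon>s s / \<epsilon>0"
    using \<eta> \<epsilon>0 by (simp add: \<beta>_def \<epsilon>s_def power_divide)
  have "2 * \<epsilon>s s + M s \<le> 2 * \<epsilon>s s + \<beta> s * ?W" using Mterm_bound[of s] by simp
  also have "\<dots> \<le> 2 * \<epsilon>s s * (\<rho> / \<eta>) ^ s + \<beta> s * ?W" using q1 \<epsilon>_pos[of s] by simp
  also have "\<dots> = (4 / \<eta> + 2 * ?W * \<beta>0 / (\<epsilon>0 * \<eta>)) * (\<rho> / \<eta>) ^ s * (\<epsilon>s s * \<eta> / 2)"
    unfolding b using \<eta> \<epsilon>0 by (simp add: field_simps)
  also have "\<dots> \<le> 2 ^ \<alpha> * (2 ^ \<alpha>) ^ s * (\<epsilon>s s * \<eta> / 2)"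
    using e assms(2,3) \<eta> \<rho> by (intro mult_right_mono mult_mono power_mono) auto
  also have "\<dots> = 2 ^ (\<alpha> * Suc s) * \<epsilon>s (Suc s) / 2"
    by (simp add: \<epsilon>s_def power_add power_mult)
  finally have "2 * \<epsilon>s s + M s \<le> 2 ^ (\<alpha> * Suc s) * \<epsilon>s (Suc s) / 2" .
  from least_inner_iterations(2)[OF K_ge \<epsilon>_pos _ this, of "Suc s"] assms(1)
  show ?thesis by (simp add: m_Suc)
qed

lemma total_iterations_bound:
  assumes "1 \<le> \<alpha>" "\<rho> / \<eta> \<le> 2 ^ \<alpha>"
    and "4 / \<eta> + 2 * (R\<^sup>2 * (24 + 2 / \<rho>\<^sup>2 + 4 / (2 * \<rho> - 1))) * \<beta>0 / (\<epsilon>0 * \<eta>) \<le> 2 ^ \<alpha>"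
    and B: "\<And>t. t \<le> s \<Longrightarrow> K t \<le> B"
  shows "(\<Sum>t\<le>s. real (m t)) \<le> real m0 + real s * (real \<alpha> * real s * B + 1)"
proof -
  have "real (m (Suc t)) \<le> real \<alpha> * real s * B + 1" if "t < s" for t
  proof -
    have "real (m (Suc t)) \<le> real (\<alpha> * Suc t) * K (Suc t) + 1"
      by (rule inner_iterations_bound[OF assms(1-3)])
    also have "real (\<alpha> * Suc t) * K (Suc t) \<le> (real \<alpha> * real s) * B"
    proof (rule mult_mono)
      show "K (Suc t) \<le> B" using B that by simp
      have "\<alpha> * Suc t \<le> \<alpha> * s" using that by (intro mult_le_mono2) simp
      then show "real (\<alpha> * Suc t) \<le> real \<alpha> * real s" unfolding of_nat_mult[symmetric] of_nat_le_iff .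
    qed (use K_ge[of "Suc t"] in auto)
    finally show ?thesis by simp
  qed
  then have "(\<Sum>t<s. real (m (Suc t))) \<le> (\<Sum>t<s. real \<alpha> * real s * B + 1)" by (intro sum_mono) auto
  moreover have "(\<Sum>t\<le>s. real (m t)) = real (m 0) + (\<Sum>t<s. real (m (Suc t)))"
    by (simp add: sum.atMost_shift)
  ultimately show ?thesis by (simp add: run_start(1))
qed

lemma stage_accuracy:
  shows "Fobj P (x s) - Fstar P = ereal (G (x s) + ph1 P (A1 P (x s)) - Fs)"
    and "\<bar>G (x s) + ph1 P (A1 P (x s)) - Fs\<bar> \<le> (9 * R\<^sup>2 + 2 * R + \<epsilon>0 / \<beta>0) * \<beta> s"
    and "infdist (A2 P (x s)) (pK P) \<le> (9 * R\<^sup>2 + 2 * R + \<epsilon>0 / \<beta>0) * \<beta> s"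
proof -
  show "Fobj P (x s) - Fstar P = ereal (G (x s) + ph1 P (A1 P (x s)) - Fs)"
    by (simp add: Fobj_def fg_eq_G[OF x_dom] Fstar_eq)
  let ?b = "\<beta> s" and ?d = "norm (lam (Suc s) - lam s)"
  have b: "0 < ?b" by (rule \<beta>_pos)
  note acc = accuracy_of_near_min[OF \<beta>_pos lam_Rd near_min_run, of s, folded lam_Suc]
  note B = iterate_bounds[of s] iterate_bounds[of "Suc s"]
  have bd: "?b * ?d \<le> ?b * (2 * R)" using b B(3) by simp
  have "\<eta> ^ s \<le> \<rho> ^ s" using \<eta> by (intro power_mono) auto
  then have "\<epsilon>0 * \<eta> ^ s \<le> \<epsilon>0 * \<rho> ^ s" using \<epsilon>0 by simp
  then have e: "\<epsilon>s s \<le> \<epsilon>0 / \<beta>0 * ?b" using \<beta>0 by (simp add: \<epsilon>s_def \<beta>_def)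
  have nn: "0 \<le> R\<^sup>2 * ?b" "0 \<le> R * ?b" "0 \<le> \<epsilon>0 / \<beta>0 * ?b"
    using b R_nonneg \<epsilon>0 \<beta>0 by simp_all
  have Q: "(9 * R\<^sup>2 + 2 * R + \<epsilon>0 / \<beta>0) * ?b = 9 * (R\<^sup>2 * ?b) + 2 * (R * ?b) + \<epsilon>0 / \<beta>0 * ?b"
    by (simp add: algebra_simps)
  show "infdist (A2 P (x s)) (pK P) \<le> (9 * R\<^sup>2 + 2 * R + \<epsilon>0 / \<beta>0) * ?b"
    using acc(1) bd nn unfolding Q by (simp add: mult.commute mult.left_commute)
  have "norm lo * (?b * ?d) \<le> R * (?b * (2 * R))"
    using R_lo bd b R_nonneg by (intro mult_mono) auto
  also have "\<dots> = 2 * (R\<^sup>2 * ?b)" by (simp add: power2_eq_square)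
  finally have low: "Fs - 2 * (R\<^sup>2 * ?b) \<le> G (x s) + ph1 P (A1 P (x s))" using acc(2) by linarith
  have "(norm (xo - prev x' x s))\<^sup>2 \<le> R\<^sup>2"
    using B(1) by (intro power_mono) (auto simp: norm_minus_commute)
  then have "?b / 2 * (norm (xo - prev x' x s))\<^sup>2 \<le> ?b / 2 * R\<^sup>2"
    using b by (intro mult_left_mono) auto
  moreover have "?b * ?d * (Lh + norm (lam (Suc s)) + ?d / 2) \<le> ?b * (2 * R) * (R + 2 * R + R)"
    using bd B(3,6) R_Lh Lh_nonneg R_nonneg b by (intro mult_mono add_mono) auto
  moreover have "?b / 2 * R\<^sup>2 = 1 / 2 * (R\<^sup>2 * ?b)" by simp
  moreover have "?b * (2 * R) * (R + 2 * R + R) = 8 * (R\<^sup>2 * ?b)" by (simp add: power2_eq_square)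
  ultimately have "G (x s) + ph1 P (A1 P (x s)) \<le> Fs + \<epsilon>0 / \<beta>0 * ?b + 1 / 2 * (R\<^sup>2 * ?b) + 8 * (R\<^sup>2 * ?b)"
    using acc(3) e by linarith
  with low show "\<bar>G (x s) + ph1 P (A1 P (x s)) - Fs\<bar> \<le> (9 * R\<^sup>2 + 2 * R + \<epsilon>0 / \<beta>0) * ?b"
    using nn unfolding Q abs_le_iff by linarith
qed

end

section \<open>Complexity\<close>

text \<open>
  The radius required by the outer loop is a function of \<open>c\<^sub>1\<close> and \<open>\<beta>0\<close> alone, because \<open>c\<^sub>1\<close> dominates
  \<open>c\<^sub>0 \<beta>0\<close> and \<open>2 Lh\<^sup>2 \<beta>0\<close>.
\<close>

lemma ipalm_radius:
  assumes "0 < \<beta>0" "0 < \<epsilon>0" "0 < \<eta>" "\<eta> < \<rho>" "0 \<le> Lh"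
    and c0: "c0 = c0_const \<rho> \<eta> \<beta>0 \<epsilon>0 x' lam0 xo lo"
    and c1: "c1 = c1_const \<beta>0 \<epsilon>0 Lh c0 lo"
  defines "R \<equiv> sqrt (2 * \<bar>c1\<bar> / \<beta>0)"
  shows "norm ((x', lam0) - (xo, lo)) + 4 * sqrt (\<epsilon>0 / \<beta>0) / (1 - sqrt (\<eta> / \<rho>)) \<le> R"
    and "norm xo \<le> R" and "norm lo \<le> R" and "Lh \<le> R"
proof -
  define u where "u = norm ((x', lam0) - (xo, lo))"
  define v where "v = 2 * sqrt (\<epsilon>0 / \<beta>0) / (1 - sqrt (\<eta> / \<rho>))"
  define w where "w = u + v"
  have u: "0 \<le> u" by (simp add: u_def)
  have v: "0 \<le> v" using assms by (simp add: v_def)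
  have c0': "c0 = 2 * w\<^sup>2 + 2 * (norm lo)\<^sup>2 + 2 * (norm xo)\<^sup>2"
    by (simp add: c0 c0_const_def w_def u_def v_def)
  then have c0n: "0 \<le> c0" by simp
  have c1ge: "\<epsilon>0 + 2 * Lh\<^sup>2 * \<beta>0 + c0 * \<beta>0 \<le> c1" by (simp add: c1 c1_const_def)
  have Lb: "0 \<le> 2 * Lh\<^sup>2 * \<beta>0" "0 \<le> c0 * \<beta>0" using assms(1) c0n by simp_all
  then have c1n: "0 \<le> c1" using c1ge assms(2) by linarith
  have R2: "R\<^sup>2 = 2 * c1 / \<beta>0" and Rn: "0 \<le> R" using c1n assms(1) by (simp_all add: R_def)
  have "\<beta>0 * R\<^sup>2 = 2 * c1" using assms(1) by (simp add: R2)
  then have "\<beta>0 * (2 * c0 + 4 * Lh\<^sup>2) \<le> \<beta>0 * R\<^sup>2" using c1ge assms(2) by (simp add: algebra_simps)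
  then have key: "2 * c0 + 4 * Lh\<^sup>2 \<le> R\<^sup>2" using assms(1) by simp
  have sq: "0 \<le> w\<^sup>2" "0 \<le> (norm lo)\<^sup>2" "0 \<le> (norm xo)\<^sup>2" "0 \<le> Lh\<^sup>2" by simp_all
  have "4 * W \<le> r \<and> a \<le> r \<and> b \<le> r \<and> c \<le> r"
    if "2 * (2 * W + 2 * a + 2 * b) + 4 * c \<le> r" "0 \<le> W" "0 \<le> a" "0 \<le> b" "0 \<le> c"
    for W a b c r :: real
    using that by simp
  from this[OF key[unfolded c0'] sq]
  have sqs: "4 * w\<^sup>2 \<le> R\<^sup>2" "(norm xo)\<^sup>2 \<le> R\<^sup>2" "(norm lo)\<^sup>2 \<le> R\<^sup>2" "Lh\<^sup>2 \<le> R\<^sup>2" by blast+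
  have "(2 * w)\<^sup>2 \<le> R\<^sup>2" using sqs(1) by (simp add: power_mult_distrib)
  then have "2 * w \<le> R" using Rn by (rule power2_le_imp_le)
  then have le: "u + 2 * v \<le> R" using u by (simp add: w_def)
  have v4: "4 * sqrt (\<epsilon>0 / \<beta>0) / (1 - sqrt (\<eta> / \<rho>)) = 2 * v" by (simp add: v_def)
  show "norm ((x', lam0) - (xo, lo)) + 4 * sqrt (\<epsilon>0 / \<beta>0) / (1 - sqrt (\<eta> / \<rho>)) \<le> R"
    unfolding v4 u_def[symmetric] by (rule le)
  show "norm xo \<le> R" "norm lo \<le> R" "Lh \<le> R"
    using sqs(2-4) Rn by (auto intro: power2_le_imp_le)
qed

text \<open>
  The first stage with error below \<open>\<epsilon>\<close> comes after logarithmically many stages, and by minimality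
  its \<open>\<beta>\<close> is still of the order of \<open>\<epsilon>\<close>.
\<close>

lemma first_accurate_stage:
  fixes \<rho> \<beta>0 Q :: real
  assumes "0 < \<rho>" "\<rho> < 1" "0 < \<beta>0" "0 < Q"
  obtains C where "1 \<le> C"
    and "\<And>\<epsilon>. 0 < \<epsilon> \<Longrightarrow> \<epsilon> < 1 \<Longrightarrow> \<exists>s. Q * (\<beta>0 * \<rho> ^ s) \<le> \<epsilon> \<and> \<epsilon> \<le> C * (\<beta>0 * \<rho> ^ s)
      \<and> real s \<le> C * (1 + ln (1 / \<epsilon>))"
proof
  define D where "D = (\<bar>ln (Q * \<beta>0)\<bar> + 1) / ln (1 / \<rho>)"
  define C where "C = 1 + 1 / \<beta>0 + Q / \<rho> + D"
  have l\<rho>: "0 < ln (1 / \<rho>)" using assms by (simp add: ln_div)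
  have D: "0 \<le> D" using l\<rho> by (simp add: D_def)
  have nn: "0 \<le> 1 / \<beta>0" "0 \<le> Q / \<rho>" using assms by simp_all
  show "1 \<le> C" using D nn unfolding C_def by linarith
  fix \<epsilon> :: real assume \<epsilon>: "0 < \<epsilon>" "\<epsilon> < 1"
  let ?p = "\<lambda>s. Q * (\<beta>0 * \<rho> ^ s) \<le> \<epsilon>"
  have L: "0 \<le> ln (1 / \<epsilon>)" using \<epsilon> by simp
  have "\<exists>s. \<rho> ^ s < \<epsilon> / (Q * \<beta>0)"
    using assms \<epsilon> by (intro real_arch_pow_inv) auto
  then have "\<exists>s. ?p s" using assms by (auto simp: field_simps intro: less_imp_le)
  then obtain s where s: "?p s" "\<And>t. t < s \<Longrightarrow> \<not> ?p t" using exists_least_iff[of ?p] by auto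
  have "\<epsilon> \<le> C * (\<beta>0 * \<rho> ^ s) \<and> real s \<le> C * (1 + ln (1 / \<epsilon>))"
  proof (cases s)
    case 0
    have "\<epsilon> \<le> 1 / \<beta>0 * \<beta>0" using \<epsilon> assms by simp
    also have "\<dots> \<le> C * \<beta>0" using assms D nn by (intro mult_right_mono) (auto simp: C_def)
    finally show ?thesis using 0 \<open>1 \<le> C\<close> L by simp
  next
    case (Suc t)
    have t: "\<epsilon> < Q * (\<beta>0 * \<rho> ^ t)" using s(2)[of t] Suc by simp
    also have "\<dots> = Q / \<rho> * (\<beta>0 * \<rho> ^ s)" using Suc assms by simp
    also have "\<dots> \<le> C * (\<beta>0 * \<rho> ^ s)" using assms D nn by (intro mult_right_mono) (auto simp: C_def)
    finally have 1: "\<epsilon> \<le> C * (\<beta>0 * \<rho> ^ s)" by simp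
    have "ln \<epsilon> < ln (Q * (\<beta>0 * \<rho> ^ t))" using t \<epsilon> by simp
    also have "\<dots> = ln (Q * \<beta>0) - real t * ln (1 / \<rho>)"
      using assms by (simp add: ln_mult ln_div ln_realpow)
    finally have "real t * ln (1 / \<rho>) \<le> \<bar>ln (Q * \<beta>0)\<bar> + ln (1 / \<epsilon>)"
      using \<epsilon> by (simp add: ln_div)
    also have "\<dots> \<le> (\<bar>ln (Q * \<beta>0)\<bar> + 1) * (1 + ln (1 / \<epsilon>))"
      using L mult_nonneg_nonneg[OF abs_ge_zero[of "ln (Q * \<beta>0)"] L] by (simp add: algebra_simps)
    finally have "real t \<le> D * (1 + ln (1 / \<epsilon>))" using l\<rho> by (simp add: D_def field_simps)
    moreover have "1 + ln (1 / \<epsilon>) \<le> (1 + 1 / \<beta>0 + Q / \<rho>) * (1 + ln (1 / \<epsilon>))"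
      using L mult_right_mono[of 1 "1 + 1 / \<beta>0 + Q / \<rho>" "1 + ln (1 / \<epsilon>)"] nn by simp
    moreover have "C * (1 + ln (1 / \<epsilon>)) = (1 + 1 / \<beta>0 + Q / \<rho>) * (1 + ln (1 / \<epsilon>)) + D * (1 + ln (1 / \<epsilon>))"
      unfolding C_def by (rule distrib_right)
    moreover have "real s = real t + 1" using Suc by simp
    ultimately have "real s \<le> C * (1 + ln (1 / \<epsilon>))" using L by linarith
    with 1 show ?thesis by blast
  qed
  with s(1) show "\<exists>s. Q * (\<beta>0 * \<rho> ^ s) \<le> \<epsilon> \<and> \<epsilon> \<le> C * (\<beta>0 * \<rho> ^ s) \<and> real s \<le> C * (1 + ln (1 / \<epsilon>))"
    by blast
qed

text \<open>
  Charging every stage with the most expensive one costs only the factor \<open>s\<close>, a logarithm in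
  \<open>1 / \<epsilon>\<close>; together with the linear growth of the logarithmic reduction factors this explains the
  square.
\<close>

lemma stage_count_absorbed:
  fixes a0 \<alpha> s B D X E C :: real
  assumes "0 \<le> a0" "0 \<le> \<alpha>" "0 \<le> s" "0 \<le> D" "s \<le> C * E" "1 \<le> X" "1 \<le> E" "B \<le> D * X"
  shows "a0 + s * (\<alpha> * s * B + 1) \<le> (a0 + C + \<alpha> * C\<^sup>2 * D) * X * E\<^sup>2"
proof -
  have CE: "0 \<le> C * E" using assms by linarith
  then have C: "0 \<le> C" using assms(7) by (simp add: zero_le_mult_iff)
  have "1 \<le> X * E" "1 \<le> X * E\<^sup>2" "E \<le> X * E\<^sup>2"
  proof -
    show 1: "1 \<le> X * E" using mult_mono[of 1 X 1 E] assms by simp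
    then show "E \<le> X * E\<^sup>2" using mult_right_mono[of 1 "X * E" E] assms by (simp add: power2_eq_square)
    then show "1 \<le> X * E\<^sup>2" using assms by linarith
  qed
  then have 1: "a0 \<le> a0 * (X * E\<^sup>2)" "C * E \<le> C * (X * E\<^sup>2)"
    using assms C mult_left_mono[of 1 "X * E\<^sup>2" a0] by (simp_all add: mult_left_mono)
  have "s * s * \<alpha> * B \<le> s * s * \<alpha> * (D * X)"
    using assms by (intro mult_left_mono) auto
  also have "\<dots> \<le> (C * E) * (C * E) * \<alpha> * (D * X)"
    using assms CE by (intro mult_right_mono mult_mono) auto
  also have "\<dots> = \<alpha> * C\<^sup>2 * D * (X * E\<^sup>2)" by (simp add: power2_eq_square)
  finally have "s * (\<alpha> * s * B + 1) \<le> \<alpha> * C\<^sup>2 * D * (X * E\<^sup>2) + C * (X * E\<^sup>2)"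
    using assms(5) 1 by (simp add: algebra_simps)
  with 1 show ?thesis by (simp add: algebra_simps)
qed

text \<open>
  One bound for all stages up to the one with parameter \<open>\<beta>\<close>: \<open>\<gamma>\<close> will be \<open>min \<mu>g \<mu>\<close> if this is
  positive, and \<open>\<beta>\<close> itself otherwise.
\<close>

lemma inner_rate_bound:
  fixes nA Lf \<beta> \<beta>' \<beta>0 \<mu> \<mu>g \<gamma> :: real
  assumes "0 < \<beta>" "\<beta> \<le> \<beta>'" "\<beta>' \<le> \<beta>0" "0 < Lf" "0 < \<gamma>" "\<gamma> \<le> \<mu>" "\<gamma> \<le> \<beta>' + \<mu>g"
    and "K \<le> 2 * max (nA\<^sup>2 / \<beta>') Lf / min (\<beta>' + \<mu>g) \<mu> + 1"
  shows "K \<le> 2 * max (nA\<^sup>2) (Lf * \<beta>0) / (\<beta> * \<gamma>) + 1"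
proof -
  let ?a = "max (nA\<^sup>2) (Lf * \<beta>0)"
  have a: "0 \<le> ?a" by (simp add: le_max_iff_disj)
  have b': "0 < \<beta>'" using assms by simp
  have "nA\<^sup>2 / \<beta>' \<le> ?a / \<beta>'" using b' by (intro divide_right_mono) auto
  moreover have "Lf * \<beta>' \<le> Lf * \<beta>0" using assms by simp
  then have "Lf * \<beta>' \<le> ?a" by simp
  then have "Lf \<le> ?a / \<beta>'" using b' by (simp add: pos_le_divide_eq)
  ultimately have "max (nA\<^sup>2 / \<beta>') Lf \<le> ?a / \<beta>'" by simp
  also have "\<dots> \<le> ?a / \<beta>" using assms a b' by (intro divide_left_mono) auto
  finally have 1: "2 * max (nA\<^sup>2 / \<beta>') Lf \<le> 2 * (?a / \<beta>)" by (rule mult_left_mono) simp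
  have "2 * max (nA\<^sup>2 / \<beta>') Lf / min (\<beta>' + \<mu>g) \<mu> \<le> 2 * (?a / \<beta>) / \<gamma>"
    using 1 a assms by (intro frac_le) auto
  then show ?thesis using assms(8) by (simp add: divide_divide_eq_left)
qed

theorem corollary7:
  fixes c1 c2 \<rho> \<eta> \<beta>0 \<epsilon>0 :: real and m0 :: nat
  assumes "1 / 2 < \<rho>" and "\<rho> < 1" and "0 < \<eta>" and "\<eta> < 1" and "\<eta> < \<rho>"
    and "0 < \<beta>0" and "0 < \<epsilon>0" and "0 < m0"
  defines "\<beta> \<equiv> \<lambda>s. \<beta>0 * \<rho> ^ s" and "\<epsilon>s \<equiv> \<lambda>s. \<epsilon>0 * \<eta> ^ s"
  shows "\<exists>C>0. \<exists>k>0. \<forall>(P :: problem) (\<xi> :: fvec \<Rightarrow> ereal) Lh Lf \<mu> \<mu>g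
      (K :: nat \<Rightarrow> real) x' lam0 xopt lamopt
      (M :: real measure) (x :: nat \<Rightarrow> real \<Rightarrow> fvec) (lam :: nat \<Rightarrow> real \<Rightarrow> fvec \<times> fvec)
      (m :: nat \<Rightarrow> real \<Rightarrow> nat).
    let c0 = c0_const \<rho> \<eta> \<beta>0 \<epsilon>0 x' lam0 xopt lamopt;
        a = max ((normA P)\<^sup>2) (Lf * \<beta>0);
        b = min \<mu>g \<mu>
    in
      standing_assumptions P Lh \<and>
      relatively_smooth P \<xi> \<mu> Lf \<and>
      0 \<le> \<mu>g \<and> strongly_convex (dimx P) \<mu>g (pg P) \<and>
      primal_optimal P xopt \<and> dual_optimal P lamopt \<and>
      x' \<in> domg P \<and> lam0 \<in> domhconj P \<and>
      c1 = c1_const \<beta>0 \<epsilon>0 Lh c0 lamopt \<and> c2 = c2_const \<rho> \<eta> \<beta>0 \<epsilon>0 Lh c0 \<and>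
      (\<forall>s. 1 \<le> K s \<and>
           K s \<le> 2 * max ((normA P)\<^sup>2 / \<beta> s) Lf / min (\<beta> s + \<mu>g) \<mu> + 1) \<and>
      prob_space M \<and>
      (\<forall>\<omega>\<in>space M.
         ipalm_run P \<xi> Lf Lh \<beta> \<epsilon>s m0 K x' lam0 (\<lambda>s. x s \<omega>) (\<lambda>s. lam s \<omega>) (\<lambda>s. m s \<omega>) \<and>
         inner_guarantee P \<xi> Lf \<beta> K x' (\<lambda>s. x s \<omega>) (\<lambda>s. lam s \<omega>))
      \<longrightarrow>
      (b > 0 \<longrightarrow> (\<forall>\<^sub>F \<epsilon> in at_right 0.
         reached_within M P x m \<epsilon> (C * ((a + b) / (b * \<epsilon>)) * (1 + ln (1 / \<epsilon>)) ^ k))) \<and>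
      (b = 0 \<longrightarrow> (\<forall>\<^sub>F \<epsilon> in at_right 0.
         reached_within M P x m \<epsilon> (C * (a / \<epsilon>\<^sup>2) * (1 + ln (1 / \<epsilon>)) ^ k)))"
proof -
  define R where "R = sqrt (2 * \<bar>c1\<bar> / \<beta>0)"
  define Q where "Q = 9 * R\<^sup>2 + 2 * R + \<epsilon>0 / \<beta>0"
  define V where "V = 4 / \<eta> + 2 * (R\<^sup>2 * (24 + 2 / \<rho>\<^sup>2 + 4 / (2 * \<rho> - 1))) * \<beta>0 / (\<epsilon>0 * \<eta>)"
  have R0: "0 \<le> R" using assms by (simp add: R_def)
  have Q0: "0 < Q" using R0 assms by (auto simp: Q_def intro!: add_nonneg_pos)
  obtain \<alpha>' where \<alpha>': "max V (\<rho> / \<eta>) < 2 ^ \<alpha>'" using real_arch_pow[of 2 "max V (\<rho> / \<eta>)"] by auto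
  define \<alpha> where "\<alpha> = Suc \<alpha>'"
  have "(2::real) ^ \<alpha>' \<le> 2 ^ \<alpha>" by (simp add: \<alpha>_def)
  with \<alpha>' have "max V (\<rho> / \<eta>) \<le> 2 ^ \<alpha>" by (meson less_imp_le order.trans)
  then have \<alpha>: "1 \<le> \<alpha>" "\<rho> / \<eta> \<le> 2 ^ \<alpha>" "V \<le> 2 ^ \<alpha>" by (simp_all add: \<alpha>_def)
  have \<rho>0: "0 < \<rho>" using assms by simp
  obtain C3 where C3: "1 \<le> C3" and stage: "\<And>\<epsilon>. 0 < \<epsilon> \<Longrightarrow> \<epsilon> < 1 \<Longrightarrow>
      \<exists>s. Q * \<beta> s \<le> \<epsilon> \<and> \<epsilon> \<le> C3 * \<beta> s \<and> real s \<le> C3 * (1 + ln (1 / \<epsilon>))"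
    using first_accurate_stage[OF \<rho>0 assms(2,6) Q0] unfolding \<beta>_def by metis
  \<comment> \<open>Large enough for the two regimes below, which need \<open>2 * C3 + 1\<close> and \<open>2 * C3\<^sup>2 + 1\<close>.\<close>
  define D' where "D' = 2 * C3\<^sup>2 + 2 * C3 + 1"
  define C where "C = real m0 + C3 + real \<alpha> * C3\<^sup>2 * D'"
  have "0 \<le> D'" using C3 by (simp add: D'_def)
  then have "0 \<le> real \<alpha> * C3\<^sup>2 * D'" by simp
  then have C: "0 < C" using C3 unfolding C_def by linarith
  show ?thesis
  proof (rule exI[of _ C], rule conjI[OF C], rule exI[of _ 2], rule conjI, simp, intro allI,
      unfold Let_def, rule impI, elim conjE)
    fix P :: problem and \<xi> and Lh Lf \<mu> \<mu>g :: real and K :: "nat \<Rightarrow> real" and x' lam0 xopt lamopt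
      and M :: "real measure" and x :: "nat \<Rightarrow> real \<Rightarrow> fvec" and lam :: "nat \<Rightarrow> real \<Rightarrow> fvec \<times> fvec"
      and m :: "nat \<Rightarrow> real \<Rightarrow> nat"
    let ?a = "max ((normA P)\<^sup>2) (Lf * \<beta>0)" and ?b = "min \<mu>g \<mu>"
    assume st: "standing_assumptions P Lh" and rel: "relatively_smooth P \<xi> \<mu> Lf" and \<mu>g: "0 \<le> \<mu>g"
      and opt: "primal_optimal P xopt" "dual_optimal P lamopt" and x': "x' \<in> domg P" and lam0: "lam0 \<in> domhconj P"
      and c1: "c1 = c1_const \<beta>0 \<epsilon>0 Lh (c0_const \<rho> \<eta> \<beta>0 \<epsilon>0 x' lam0 xopt lamopt) lamopt"
      and K: "\<forall>s. 1 \<le> K s \<and> K s \<le> 2 * max ((normA P)\<^sup>2 / \<beta> s) Lf / min (\<beta> s + \<mu>g) \<mu> + 1"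
      and M: "prob_space M"
      and runs: "\<forall>\<omega>\<in>space M.
         ipalm_run P \<xi> Lf Lh \<beta> \<epsilon>s m0 K x' lam0 (\<lambda>s. x s \<omega>) (\<lambda>s. lam s \<omega>) (\<lambda>s. m s \<omega>) \<and>
         inner_guarantee P \<xi> Lf \<beta> K x' (\<lambda>s. x s \<omega>) (\<lambda>s. lam s \<omega>)"
    interpret M: prob_space M by (rule M)
    obtain \<omega>0 where \<omega>0: "\<omega>0 \<in> space M" using M.not_empty by blast
    interpret composite_problem P Lh by standard (rule st)
    have \<mu>: "0 < \<mu>" "0 < Lf" using rel by (auto simp: relatively_smooth_def Let_def)
    have a: "0 < ?a" using \<mu> assms(6) by (simp add: less_max_iff_disj)
    note rad = ipalm_radius[OF assms(6,7,3,5) Lh_nonneg refl c1, folded R_def]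
    interpret I: ipalm P Lh xopt lamopt \<rho> \<eta> \<beta>0 \<epsilon>0 R \<xi> \<mu> Lf m0 K x' lam0
      "\<lambda>s. x s \<omega>0" "\<lambda>s. lam s \<omega>0" "\<lambda>s. m s \<omega>0" \<beta> \<epsilon>s
      using opt assms(1-7) rel x' lam0 K runs \<omega>0 rad
      unfolding \<beta>_def \<epsilon>s_def by unfold_locales auto
    have det: "x s \<omega> = x s \<omega>0 \<and> m s \<omega> = m s \<omega>0" if "\<omega> \<in> space M" for s \<omega>
      using ipalm_run_deterministic runs that \<omega>0 by blast
    have acc: "accurate M P (x s) \<epsilon>" if s: "Q * \<beta> s \<le> \<epsilon>" for s \<epsilon>
    proof -
      define d where "d = G (x s \<omega>0) + ph1 P (A1 P (x s \<omega>0)) - I.Fs"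
      have d: "Fobj P (x s \<omega>) - Fstar P = ereal d" if "\<omega> \<in> space M" for \<omega>
        using I.stage_accuracy(1)[of s] det[OF that, of s] by (simp add: d_def)
      have dQ: "\<bar>d\<bar> \<le> \<epsilon>" "infdist (A2 P (x s \<omega>0)) (pK P) \<le> \<epsilon>"
        using I.stage_accuracy(2,3)[of s] s unfolding d_def Q_def by linarith+
      have i1: "integrable M (\<lambda>\<omega>. real_of_ereal (Fobj P (x s \<omega>) - Fstar P))"
        by (rule Bochner_Integration.integrable_cong[THEN iffD2, OF refl _ M.integrable_const[of d]]) (simp add: d)
      have e1: "integral\<^sup>L M (\<lambda>\<omega>. real_of_ereal (Fobj P (x s \<omega>) - Fstar P)) = d"
        by (subst Bochner_Integration.integral_cong[OF refl, of _ _ "\<lambda>_. d"]) (simp_all add: d M.prob_space)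
      have i2: "integrable M (\<lambda>\<omega>. infdist (A2 P (x s \<omega>)) (pK P))"
        by (rule Bochner_Integration.integrable_cong[THEN iffD2, OF refl _ M.integrable_const[of "infdist (A2 P (x s \<omega>0)) (pK P)"]])
          (simp add: det)
      have e2: "integral\<^sup>L M (\<lambda>\<omega>. infdist (A2 P (x s \<omega>)) (pK P)) = infdist (A2 P (x s \<omega>0)) (pK P)"
        by (subst Bochner_Integration.integral_cong[OF refl, of _ _ "\<lambda>_. infdist (A2 P (x s \<omega>0)) (pK P)"])
          (simp_all add: det M.prob_space)
      show ?thesis
        unfolding accurate_def mean_le_def using dQ d by (simp add: i1 e1 i2 e2)
    qed
    have im: "integrable M (\<lambda>\<omega>. real (m t \<omega>))" "integral\<^sup>L M (\<lambda>\<omega>. real (m t \<omega>)) = real (m t \<omega>0)" for t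
    proof -
      show "integrable M (\<lambda>\<omega>. real (m t \<omega>))"
        by (rule Bochner_Integration.integrable_cong[THEN iffD2, OF refl _ M.integrable_const[of "real (m t \<omega>0)"]])
          (simp add: det)
      show "integral\<^sup>L M (\<lambda>\<omega>. real (m t \<omega>)) = real (m t \<omega>0)"
        by (subst Bochner_Integration.integral_cong[OF refl, of _ _ "\<lambda>_. real (m t \<omega>0)"])
          (simp_all add: det M.prob_space)
    qed
    have reach: "reached_within M P x m \<epsilon> (C * X * (1 + ln (1 / \<epsilon>))\<^sup>2)"
      if \<epsilon>: "0 < \<epsilon>" "\<epsilon> < 1" and X: "1 \<le> X"
        and s: "Q * \<beta> s \<le> \<epsilon>" "real s \<le> C3 * (1 + ln (1 / \<epsilon>))"
        and \<gamma>: "0 < \<gamma>" "\<gamma> \<le> \<mu>" "\<gamma> \<le> \<beta> s + \<mu>g" and BX: "2 * ?a / (\<beta> s * \<gamma>) + 1 \<le> D' * X"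
      for \<epsilon> X s \<gamma>
    proof -
      let ?B = "2 * ?a / (\<beta> s * \<gamma>) + 1"
      have "K t \<le> ?B" if t: "t \<le> s" for t
      proof (rule inner_rate_bound[where \<mu> = \<mu> and \<mu>g = \<mu>g and \<beta>' = "\<beta> t"])
        show "0 < \<beta> s" by (rule I.\<beta>_pos)
        show st: "\<beta> s \<le> \<beta> t" unfolding \<beta>_def using t \<rho>0 assms(2,6) by (simp add: power_decreasing)
        show "\<beta> t \<le> \<beta>0" unfolding \<beta>_def using \<rho>0 assms(2,6) by (simp add: power_le_one mult_left_le)
        show "\<gamma> \<le> \<beta> t + \<mu>g" using \<gamma>(3) st by linarith
      qed (use \<mu> \<gamma> K in auto)
      from I.total_iterations_bound[OF \<alpha>(1,2) \<alpha>(3)[unfolded V_def] this]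
      have "(\<Sum>t\<le>s. real (m t \<omega>0)) \<le> real m0 + real s * (real \<alpha> * real s * ?B + 1)" .
      also have "\<dots> \<le> C * X * (1 + ln (1 / \<epsilon>))\<^sup>2"
        unfolding C_def
        using stage_count_absorbed[of "real m0" "real \<alpha>" "real s" D' C3 "1 + ln (1 / \<epsilon>)" X ?B]
          \<open>0 \<le> D'\<close> s(2) X BX \<epsilon> by simp
      finally show ?thesis
        unfolding reached_within_def using acc[OF s(1)] im by auto
    qed
    have \<beta>_inv: "1 / \<beta> s \<le> C3 / \<epsilon>" if "0 < \<epsilon>" "\<epsilon> \<le> C3 * \<beta> s" for \<epsilon> s
      using that I.\<beta>_pos[of s] by (simp add: field_simps)
    show "(0 < ?b \<longrightarrow> (\<forall>\<^sub>F \<epsilon> in at_right 0.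
         reached_within M P x m \<epsilon> (C * ((?a + ?b) / (?b * \<epsilon>)) * (1 + ln (1 / \<epsilon>))\<^sup>2))) \<and>
      (?b = 0 \<longrightarrow> (\<forall>\<^sub>F \<epsilon> in at_right 0.
         reached_within M P x m \<epsilon> (C * (?a / \<epsilon>\<^sup>2) * (1 + ln (1 / \<epsilon>))\<^sup>2)))"
    proof (intro conjI impI)
      assume b: "0 < ?b"
      have "reached_within M P x m \<epsilon> (C * ((?a + ?b) / (?b * \<epsilon>)) * (1 + ln (1 / \<epsilon>))\<^sup>2)"
        if \<epsilon>: "0 < \<epsilon>" "\<epsilon> < 1" for \<epsilon>
      proof -
        let ?X = "(?a + ?b) / (?b * \<epsilon>)"
        obtain s where s: "Q * \<beta> s \<le> \<epsilon>" "\<epsilon> \<le> C3 * \<beta> s" "real s \<le> C3 * (1 + ln (1 / \<epsilon>))"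
          using stage[OF \<epsilon>] by blast
        have "?b * \<epsilon> \<le> ?b" by (rule mult_left_le) (use b \<epsilon> in auto)
        then have "?b * \<epsilon> \<le> ?a + ?b" using a by linarith
        then have X: "1 \<le> ?X" using b \<epsilon> by (simp add: pos_le_divide_eq)
        have "2 * ?a / (\<beta> s * ?b) = 2 * ?a / ?b * (1 / \<beta> s)" by simp
        also have "\<dots> \<le> 2 * ?a / ?b * (C3 / \<epsilon>)"
          using a b by (intro mult_left_mono \<beta>_inv[OF \<epsilon>(1) s(2)]) auto
        also have "\<dots> = 2 * C3 * (?a / (?b * \<epsilon>))" by simp
        also have "\<dots> \<le> 2 * C3 * ?X"
          using C3 b \<epsilon> by (intro mult_left_mono divide_right_mono) auto
        finally have "2 * ?a / (\<beta> s * ?b) + 1 \<le> 2 * C3 * ?X + 1 * ?X" using X by (intro add_mono) simp_all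
        also have "\<dots> = (2 * C3 + 1) * ?X" by (rule distrib_right[symmetric])
        also have "\<dots> \<le> D' * ?X" using X by (intro mult_right_mono) (auto simp: D'_def)
        finally show ?thesis
          using b I.\<beta>_pos[of s] by (intro reach[OF \<epsilon> X s(1,3), of ?b]) auto
      qed
      then show "\<forall>\<^sub>F \<epsilon> in at_right 0. reached_within M P x m \<epsilon> (C * ((?a + ?b) / (?b * \<epsilon>)) * (1 + ln (1 / \<epsilon>))\<^sup>2)"
        unfolding eventually_at_right_field by (intro exI[of _ 1]) auto
    next
      assume b: "?b = 0"
      then have \<mu>g0: "\<mu>g = 0" using \<mu> by (simp add: min_def split: if_splits)
      \<comment> \<open>Below \<open>e0\<close> the constant overhead per stage is dominated by the leading term, and the chosen stage
        satisfies \<open>\<beta> s \<le> \<mu>\<close>, so that \<open>\<beta> s\<close> can serve as \<open>\<gamma>\<close>.\<close>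
      define e0 where "e0 = min 1 (min (sqrt ?a) (Q * \<mu>))"
      have e0: "0 < e0" using a Q0 \<mu> by (simp add: e0_def)
      have "reached_within M P x m \<epsilon> (C * (?a / \<epsilon>\<^sup>2) * (1 + ln (1 / \<epsilon>))\<^sup>2)"
        if e: "0 < \<epsilon>" "\<epsilon> < e0" for \<epsilon>
      proof -
        let ?X = "?a / \<epsilon>\<^sup>2"
        have \<epsilon>: "0 < \<epsilon>" "\<epsilon> < 1" "\<epsilon> < sqrt ?a" "\<epsilon> < Q * \<mu>" using e by (auto simp: e0_def)
        obtain s where s: "Q * \<beta> s \<le> \<epsilon>" "\<epsilon> \<le> C3 * \<beta> s" "real s \<le> C3 * (1 + ln (1 / \<epsilon>))"
          using stage[OF \<epsilon>(1,2)] by blast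
        have "\<epsilon>\<^sup>2 \<le> (sqrt ?a)\<^sup>2" using \<epsilon> by (intro power_mono) auto
        then have X: "1 \<le> ?X" using a \<epsilon> by (simp add: pos_le_divide_eq)
        have "Q * \<beta> s \<le> Q * \<mu>" using s(1) \<epsilon>(4) by linarith
        then have \<beta>\<mu>: "\<beta> s \<le> \<mu>" using Q0 by simp
        have bp: "0 < \<beta> s" by (rule I.\<beta>_pos)
        have "2 * ?a / (\<beta> s * \<beta> s) = 2 * ?a * ((1 / \<beta> s) * (1 / \<beta> s))" by simp
        also have "\<dots> \<le> 2 * ?a * ((C3 / \<epsilon>) * (C3 / \<epsilon>))"
          using a bp C3 \<epsilon> by (intro mult_left_mono mult_mono \<beta>_inv[OF \<epsilon>(1) s(2)]) auto
        also have "\<dots> = 2 * C3\<^sup>2 * ?X" by (simp add: power2_eq_square)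
        finally have "2 * ?a / (\<beta> s * \<beta> s) + 1 \<le> 2 * C3\<^sup>2 * ?X + 1 * ?X" using X by (intro add_mono) simp_all
        also have "\<dots> = (2 * C3\<^sup>2 + 1) * ?X" by (rule distrib_right[symmetric])
        also have "\<dots> \<le> D' * ?X" using X C3 by (intro mult_right_mono) (auto simp: D'_def)
        finally show ?thesis
          using bp \<mu>g \<beta>\<mu> by (intro reach[OF \<epsilon>(1,2) X s(1,3), of "\<beta> s"]) auto
      qed
      then show "\<forall>\<^sub>F \<epsilon> in at_right 0. reached_within M P x m \<epsilon> (C * (?a / \<epsilon>\<^sup>2) * (1 + ln (1 / \<epsilon>))\<^sup>2)"
        unfolding eventually_at_right_field using e0 by (intro exI[of _ e0]) auto
    qed
  qed
qed

end
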